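(* Let $\mu$ be a positive Borel measure on $\mathbb{C}$ with compact and infinite support. Let $\Omega$ be a subdomain of the unbounded component of $\mathbb{C}\setminus\operatorname{supp}(\mu)$, and suppose that there is a function $g$ analytic and different from zero in $\Omega$ such that $\lim_{n\to\infty}p_n^\mu(z)/p_{n+1}^\mu(z)=g(z)$ uniformly on any compact subset of $\Omega$. Let $z_1,\dots,z_\ell\in\Omega$ with distinct $g(z_1),\dots,g(z_\ell)$, let $t_1,\dots,t_\ell>0$, and put $\sigma=\sum_{j=1}^\ell t_j\delta_{z_j}$. Then, uniformly for $z$ in compact subsets of $\Omega$, $$\lim_{n\to\infty}\frac{K_n^{\mu+\sigma}(z,z)}{K_n^\mu(z,z)}=\left|\prod_{j=1}^\ell\frac{g(z)-g(z_j)}{1-g(z)\overline{g(z_j)}}\right|^2,$$ and, at a point mass $z=z_m$ ($1\le m\le\ell$), $$K_n^{\mu+\sigma}(z_m,z_m)=\frac1{t_m}\left(1+\mathcal O\Big(\frac1{K_n^\mu(z_m,z_m)}\Big)\right)\quad\text{as }n\to\infty.$$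
   Context: For a positive Borel measure $\nu$ on $\mathbb{C}$ with compact infinite support, $p_n^\nu$ denotes the orthonormal polynomial of degree $n$ with positive leading coefficient ($\int p_n^\nu\overline{p_m^\nu}\,d\nu=\delta_{n,m}$), and $K_n^\nu(z,w)=\sum_{j=0}^np_j^\nu(z)\overline{p_j^\nu(w)}$ is the Christoffel–Darboux kernel. $\delta_x$ is the unit point mass at $x$. *)

theory Defs
  imports
    "HOL-Probability.Probability"
    "HOL-Complex_Analysis.Complex_Analysis"
    "HOL-Computational_Algebra.Polynomial"
begin

definition measure_supp :: "complex measure \<Rightarrow> complex set" where
  "measure_supp \<nu> = {z. \<forall>U. open U \<longrightarrow> z \<in> U \<longrightarrow> emeasure \<nu> U > 0}"

definition orthonormal_polys :: "complex measure \<Rightarrow> (nat \<Rightarrow> complex poly) \<Rightarrow> bool" where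
  "orthonormal_polys \<nu> p \<longleftrightarrow>
     (\<forall>n. degree (p n) = n \<and> (\<exists>c>0. lead_coeff (p n) = complex_of_real c)) \<and>
     (\<forall>n m. (LINT z|\<nu>. poly (p n) z * cnj (poly (p m) z)) = (if n = m then 1 else 0))"

(* For a finite measure with compact infinite support there is exactly one such sequence. *)
definition orthonormal_poly :: "complex measure \<Rightarrow> nat \<Rightarrow> complex poly" where
  "orthonormal_poly \<nu> = (THE p. orthonormal_polys \<nu> p)"

definition CD_kernel :: "complex measure \<Rightarrow> nat \<Rightarrow> complex \<Rightarrow> complex \<Rightarrow> complex" where
  "CD_kernel \<nu> n z w =
     (\<Sum>j\<le>n. poly (orthonormal_poly \<nu> j) z * cnj (poly (orthonormal_poly \<nu> j) w))"

(* Meaningful only when both measures live on the same measurable space. *)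
definition measure_add :: "'a measure \<Rightarrow> 'a measure \<Rightarrow> 'a measure" where
  "measure_add M N = measure_of (space M) (sets M) (\<lambda>A. emeasure M A + emeasure N A)"

(* Here return borel (z j) is the unit point mass at z j. *)
definition point_mass_sum ::
    "'i set \<Rightarrow> ('i \<Rightarrow> real) \<Rightarrow> ('i \<Rightarrow> complex) \<Rightarrow> complex measure" where
  "point_mass_sum J t z = measure_of UNIV (sets borel)
     (\<lambda>A. \<Sum>j\<in>J. emeasure (scale_measure (ennreal (t j)) (return borel (z j))) A)"

lemma space_measure_add [simp]: "space (measure_add M N) = space M"
  by (simp add: measure_add_def)

lemma sets_measure_add [simp, measurable_cong]: "sets (measure_add M N) = sets M"
  by (simp add: measure_add_def)

lemma emeasure_measure_add:
  assumes "sets N = sets M" and "A \<in> sets M"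
  shows "emeasure (measure_add M N) A = emeasure M A + emeasure N A"
  unfolding measure_add_def
proof (rule emeasure_measure_of_sigma)
  show "sigma_algebra (space M) (sets M)" ..
  show "positive (sets M) (\<lambda>A. emeasure M A + emeasure N A)"
    by (simp add: positive_def)
  show "countably_additive (sets M) (\<lambda>A. emeasure M A + emeasure N A)"
  proof (rule countably_additiveI)
    fix F :: "nat \<Rightarrow> 'a set"
    assume F: "range F \<subseteq> sets M" "disjoint_family F"
    have "(\<Sum>i. emeasure M (F i) + emeasure N (F i)) =
        (\<Sum>i. emeasure M (F i)) + (\<Sum>i. emeasure N (F i))"
      by (intro suminf_add[symmetric]) auto
    then show "(\<Sum>i. emeasure M (F i) + emeasure N (F i)) =
        emeasure M (\<Union>(range F)) + emeasure N (\<Union>(range F))"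
      using F assms(1) by (simp add: suminf_emeasure)
  qed
qed (fact assms(2))

lemma space_point_mass_sum [simp]: "space (point_mass_sum J t z) = UNIV"
  by (simp add: point_mass_sum_def)

lemma sets_point_mass_sum [simp, measurable_cong]: "sets (point_mass_sum J t z) = sets borel"
proof -
  interpret sigma_algebra UNIV "sets (borel :: complex measure)"
    using sets.sigma_algebra_axioms[of "borel :: complex measure"] by simp
  show ?thesis by (simp add: point_mass_sum_def)
qed

lemma emeasure_point_mass_sum:
  assumes "A \<in> sets borel"
  shows "emeasure (point_mass_sum J t z) A = (\<Sum>j\<in>J. ennreal (t j) * indicator A (z j))"
proof -
  let ?m = "\<lambda>j. scale_measure (ennreal (t j)) (return borel (z j))"
  have "emeasure (point_mass_sum J t z) A = (\<Sum>j\<in>J. emeasure (?m j) A)"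
    unfolding point_mass_sum_def
  proof (rule emeasure_measure_of_sigma)
    show "sigma_algebra UNIV (sets (borel :: complex measure))"
      using sets.sigma_algebra_axioms[of "borel :: complex measure"] by simp
    show "positive (sets borel) (\<lambda>A. \<Sum>j\<in>J. emeasure (?m j) A)"
      by (simp add: positive_def)
    show "countably_additive (sets borel) (\<lambda>A. \<Sum>j\<in>J. emeasure (?m j) A)"
    proof (rule countably_additiveI)
      fix F :: "nat \<Rightarrow> complex set"
      assume F: "range F \<subseteq> sets borel" "disjoint_family F"
      have "(\<Sum>i. \<Sum>j\<in>J. emeasure (?m j) (F i)) = (\<Sum>j\<in>J. \<Sum>i. emeasure (?m j) (F i))"
        by (intro suminf_sum) auto
      also have "\<dots> = (\<Sum>j\<in>J. emeasure (?m j) (\<Union>(range F)))"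
        using F by (intro sum.cong refl suminf_emeasure) auto
      finally show "(\<Sum>i. \<Sum>j\<in>J. emeasure (?m j) (F i)) =
          (\<Sum>j\<in>J. emeasure (?m j) (\<Union>(range F)))" .
    qed
  qed (fact assms)
  then show ?thesis
    using assms by simp
qed

end

theory Submission
  imports Defs
begin

text \<open>
  Adding one point mass changes the Christoffel-Darboux kernel by a rank-one term: the reproducing
  property identifies the kernel of \<open>\<nu> + t \<delta>\<^sub>a\<close> as
  \<open>K z w - t * K z a * K a w / (1 + t * K a a)\<close>, where \<open>K\<close> is the kernel of \<open>\<nu>\<close>.  So the masses can
  be added one at a time, provided that the induction hypothesis controls the kernel off the
  diagonal.

  All kernels are measured against the orthonormal polynomials \<open>p\<^sub>n\<close> of \<open>\<mu>\<close>, that is, divided by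
  \<open>p\<^sub>n z * cnj (p\<^sub>n w)\<close>.  For \<open>\<mu>\<close> itself this quotient \<open>S\<^sub>n\<close> satisfies
  \<open>S\<^sub>n\<^sub>+\<^sub>1 = 1 + S\<^sub>n * r\<^sub>n z * cnj (r\<^sub>n w)\<close> with \<open>r\<^sub>n = p\<^sub>n / p\<^sub>n\<^sub>+\<^sub>1\<close>, and as \<open>r\<^sub>n\<close> tends to \<open>g\<close> and \<open>\<bar>g\<bar> < 1\<close>,
  it tends to the fixed point \<open>1 / (1 - g z * cnj (g w))\<close> (\<open>scaled_CD_kernel_limit\<close>).  In the limit
  a new mass at \<open>a\<close> subtracts \<open>R z a * R a w / R a a\<close> from the current limit kernel \<open>R\<close>: the weight
  of the mass disappears because \<open>\<bar>p\<^sub>n a\<bar>\<close> tends to infinity.  For a kernel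
  \<open>R z w = B z * cnj (B w) / (1 - g z * cnj (g w))\<close> this subtraction just multiplies \<open>B\<close> by the
  Blaschke factor \<open>(g z - g a) / (1 - g z * cnj (g a))\<close> (\<open>limit_kernel_insert\<close>); it requires
  \<open>B a \<noteq> 0\<close>, which is where the values of \<open>g\<close> at the masses have to be distinct.  The induction is
  \<open>scaled_limit_point_masses\<close>, and its restriction to the diagonal gives the first claim.

  For the second claim the mass at \<open>z\<^sub>m\<close> is added last.  With \<open>K\<close> the diagonal kernel of \<open>\<mu>\<close> plus
  the other masses, the new value at \<open>z\<^sub>m\<close> is \<open>K / (1 + t * K)\<close>, which is \<open>1 / t\<close> up to a relative
  error \<open>1 / (1 + t * K)\<close>; by the first claim \<open>K\<close> is a positive multiple of the diagonal kernel
  of \<open>\<mu>\<close>, asymptotically.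

  The unbounded component of the complement of the support enters through the bound \<open>\<bar>g\<bar> < 1\<close>, which
  can fail in bounded components: for arc length on the unit circle, \<open>g z = 1 / z\<close> on both sides of
  the circle.  A point \<open>a\<close> of the unbounded component has a polynomial that is \<open>1\<close> at \<open>a\<close> and at
  most some \<open>c < 1\<close> in modulus on the support
  (\<open>peak_polynomial_unbounded_component\<close>); its powers force the diagonal kernel at \<open>a\<close> to grow
  exponentially, while a ratio limit of modulus at least \<open>1\<close> would make it grow subexponentially
  (\<open>ratio_limit_less_one\<close>).
\<close>

section \<open>Peak polynomials off the polynomial hull\<close>

definition peaks_over :: "complex set \<Rightarrow> complex \<Rightarrow> complex poly \<Rightarrow> real \<Rightarrow> bool" where
  "peaks_over K a q c \<longleftrightarrow> poly q a = 1 \<and> 0 \<le> c \<and> c < 1 \<and> (\<forall>w\<in>K. cmod (poly q w) \<le> c)"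

text \<open>
  A large power of the given peak polynomial \<open>q\<close> is almost \<open>0\<close> on \<open>K\<close>, so the polynomial
  \<open>r = (1 - q ^ k) / (w - a)\<close> is close to \<open>1 / (w - a)\<close> there.  As \<open>b\<close> is closer to \<open>a\<close> than \<open>K\<close> is,
  the geometric series \<open>\<Sum>j. (b - a) ^ j / (w - a) ^ (j + 1)\<close> for \<open>1 / (w - b)\<close> converges uniformly
  on \<open>K\<close>.  With \<open>r\<close> in place of \<open>1 / (w - a)\<close> a partial sum is a polynomial \<open>s\<close> such that
  \<open>(w - b) * s\<close> is close to \<open>1\<close> on \<open>K\<close>, and \<open>1 - (w - b) * s\<close> is a peak polynomial at \<open>b\<close>.
\<close>
lemma peaks_over_nearby:
  assumes pk: "peaks_over K a q c" and dist: "\<And>w. w \<in> K \<Longrightarrow> d \<le> cmod (w - a)"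
    and near: "cmod (b - a) < d"
  shows "\<exists>q. peaks_over K b q (1/2)"
proof -
  have d: "d > 0" using near norm_ge_zero[of "b - a"] by linarith
  define x where "x = cmod (b - a) / d"
  have x: "0 \<le> x" "x < 1" using d near by (auto simp: x_def)
  \<comment> \<open>chosen so that \<open>(1 + e) * x \<le> R < 1\<close> and \<open>e / (1 - R) = 1 / 4\<close>: each of the two error terms is at most \<open>1 / 4\<close>\<close>
  define e where "e = (1 - x) / 8"
  define R where "R = (x + 1) / 2"
  have e: "0 < e" "e \<le> 1" and R: "0 < R" "R < 1" using x by (auto simp: e_def R_def)
  have eR: "e / (1 - R) = 1 / 4" using x by (simp add: e_def R_def field_simps)
  have "e * x \<le> e" using e x mult_left_le[of x e] by simp
  moreover have "x + e \<le> R" using x by (simp add: e_def R_def field_simps)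
  ultimately have xR: "(1 + e) * x \<le> R" by (simp add: algebra_simps)
  from pk have q: "poly q a = 1" "0 \<le> c" "c < 1" "\<And>w. w \<in> K \<Longrightarrow> cmod (poly q w) \<le> c"
    by (auto simp: peaks_over_def)
  obtain k where k: "c ^ k < e" using real_arch_pow_inv[OF e(1) q(3)] by auto
  obtain N where N: "R ^ N < 1/4" using real_arch_pow_inv[of "1/4" R] R by auto
  have "poly (1 - q ^ k) a = 0" using q(1) by simp
  then have "[:- a, 1:] dvd 1 - q ^ k" by (simp only: poly_eq_0_iff_dvd)
  then obtain r where r: "1 - q ^ k = [:- a, 1:] * r" by (elim dvdE)
  define S where "S = (\<Sum>j<N. (smult (b - a) r) ^ j)"
  define Q where "Q = 1 - [:- b, 1:] * r * S"
  have "poly Q b = 1" by (simp add: Q_def)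
  moreover have "cmod (poly Q w) \<le> 1/2" if w: "w \<in> K" for w
  proof -
    define E where "E = poly q w ^ k"
    define \<rho> where "\<rho> = (b - a) * poly r w"
    define G where "G = (\<Sum>j<N. \<rho> ^ j)"
    have E: "cmod E \<le> e"
    proof -
      have "cmod E \<le> c ^ k" unfolding E_def norm_power using q(4)[OF w] by (intro power_mono) auto
      then show ?thesis using k by simp
    qed
    have h: "(w - a) * poly r w = 1 - E"
    proof -
      have "poly (1 - q ^ k) w = poly ([:- a, 1:] * r) w" by (simp only: r)
      then show ?thesis by (simp add: E_def algebra_simps)
    qed
    have "d * cmod (poly r w) \<le> cmod (w - a) * cmod (poly r w)"
      using dist[OF w] by (intro mult_right_mono) auto
    also have "\<dots> = cmod (1 - E)" by (simp add: h flip: norm_mult)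
    also have "\<dots> \<le> 1 + e" using norm_triangle_ineq4[of 1 E] E by simp
    finally have "cmod (poly r w) \<le> (1 + e) / d" using d by (simp add: field_simps)
    then have "cmod \<rho> \<le> cmod (b - a) * ((1 + e) / d)"
      unfolding \<rho>_def norm_mult by (intro mult_left_mono) auto
    also have "\<dots> = (1 + e) * x" by (simp add: x_def)
    finally have \<rho>: "cmod \<rho> \<le> R" using xR by simp
    have "cmod G \<le> (\<Sum>j<N. R ^ j)" unfolding G_def
      by (rule sum_norm_le) (auto simp: norm_power intro: power_mono[OF \<rho>])
    also have "\<dots> \<le> 1 / (1 - R)" using R by (simp add: sum_gp_strict field_simps)
    finally have G: "cmod G \<le> 1 / (1 - R)" .
    have geo: "(1 - \<rho>) * G = 1 - \<rho> ^ N" unfolding G_def by (rule one_diff_power_eq[symmetric])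
    \<comment> \<open>\<open>h\<close> turns \<open>(w - b) * r\<close> into \<open>1 - \<rho> - E\<close>, so \<open>geo\<close> leaves only the terms \<open>\<rho> ^ N\<close> and \<open>E * G\<close>\<close>
    have "poly S w = G"
      by (simp add: S_def G_def \<rho>_def poly_sum poly_power)
    then have "poly Q w = 1 - (w - b) * poly r w * G" by (simp add: Q_def algebra_simps)
    also have "(w - b) * poly r w = (w - a) * poly r w - \<rho>" by (simp add: \<rho>_def algebra_simps)
    also have "1 - ((w - a) * poly r w - \<rho>) * G = 1 - (1 - \<rho>) * G + E * G"
      unfolding h by (simp add: algebra_simps)
    also have "\<dots> = \<rho> ^ N + E * G" by (simp add: geo)
    finally have "cmod (poly Q w) \<le> cmod \<rho> ^ N + cmod E * cmod G"
      by (metis norm_triangle_ineq norm_mult norm_power)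
    also have "\<dots> \<le> R ^ N + e * (1 / (1 - R))"
      using \<rho> E G e R by (intro add_mono power_mono mult_mono) auto
    finally show ?thesis using N eR by simp
  qed
  ultimately show ?thesis by (intro exI[of _ Q]) (simp add: peaks_over_def)
qed

text \<open>
  The set of points of \<open>V\<close> with a peak polynomial is open and closed in \<open>V\<close>, since a peak
  polynomial can be moved from \<open>a\<close> by any distance less than the distance of \<open>a\<close> to \<open>K\<close>.  It contains
  all points of \<open>V\<close> of large modulus, where a multiple of the monomial \<open>w\<close> is a peak polynomial.
\<close>
lemma peak_polynomial_unbounded_component:
  assumes K: "compact K" and V: "V \<in> components (- K)" and unb: "\<not> bounded V" and a: "a \<in> V"
  obtains q c where "peaks_over K a q c"
proof (cases "K = {}")
  case True
  then show ?thesis using that[of 1 0] by (simp add: peaks_over_def)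
next
  case ne: False
  define A where "A = {b. \<exists>q c. peaks_over K b q c}"
  have op: "open (- K)" using K by (simp add: compact_imp_closed open_Compl)
  have VK: "V \<subseteq> - K" using V by (rule in_components_subset)
  have Vopen: "open V" using op V by (rule open_components)
  have pos: "0 < infdist b K" if "b \<in> V" for b
    using in_closed_iff_infdist_zero[OF compact_imp_closed[OF K] ne, of b] infdist_nonneg[of b K]
      that VK by force
  have le: "infdist b K \<le> cmod (w - b)" if "w \<in> K" for b w
    using infdist_le[OF that, of b] by (simp add: dist_norm norm_minus_commute)
  have step: "b \<in> A" if aA: "a \<in> A" and near: "cmod (b - a) < infdist a K" for a b
  proof -
    obtain q c where "peaks_over K a q c" using aA unfolding A_def by blast
    then show ?thesis using peaks_over_nearby[OF _ le near] unfolding A_def by blast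
  qed
  have "openin (top_of_set V) (V \<inter> A)"
  proof -
    have "\<exists>T. open T \<and> b \<in> T \<and> T \<subseteq> V \<inter> A" if b: "b \<in> V \<inter> A" for b
    proof (intro exI conjI)
      show "open (V \<inter> ball b (infdist b K))" using Vopen by auto
      show "b \<in> V \<inter> ball b (infdist b K)" using pos b by auto
      show "V \<inter> ball b (infdist b K) \<subseteq> V \<inter> A"
        using step[of b] b by (auto simp: dist_norm norm_minus_commute)
    qed
    then have "open (V \<inter> A)" by (subst open_subopen) blast
    then show ?thesis by (simp add: openin_open_Int openin_open_eq[OF Vopen])
  qed
  moreover have "closedin (top_of_set V) (V \<inter> A)"
  proof -
    have "b \<in> A" if b: "b \<in> V" "b \<in> closure (V \<inter> A)" for b
    proof -
      have "infdist b K / 2 > 0" using pos b by simp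
      then obtain y where y: "y \<in> V \<inter> A" "dist y b < infdist b K / 2"
        using b(2) unfolding closure_approachable by blast
      have "infdist b K \<le> infdist y K + dist b y" by (rule infdist_triangle)
      then have "cmod (b - y) < infdist y K" using y(2) by (simp add: dist_norm norm_minus_commute)
      then show ?thesis using step[of y b] y by auto
    qed
    then have "V \<inter> A = V \<inter> closure (V \<inter> A)" using closure_subset[of "V \<inter> A"] by auto
    then show ?thesis by (metis closed_closure closedin_closed)
  qed
  moreover have "V \<inter> A \<noteq> {}"
  proof -
    obtain M where M: "\<And>w. w \<in> K \<Longrightarrow> cmod w \<le> M" using compact_imp_bounded[OF K] bounded_iff by blast
    then obtain b where b: "b \<in> V" "cmod b > max M 0" using unb unfolding bounded_iff
      by (meson not_le)
    have "peaks_over K b [:0, 1 / b:] (max M 0 / cmod b)"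
      using b M by (auto simp: peaks_over_def norm_divide divide_simps le_max_iff_disj)
    then show ?thesis using b unfolding A_def by auto
  qed
  ultimately have "V \<inter> A = V"
    using in_components_connected[OF V] unfolding connected_clopen by blast
  then show ?thesis using a that unfolding A_def by blast
qed

section \<open>Adding a point mass to a measure\<close>

text \<open>
  A relation rather than an operation: the measures that occur in the induction arise by adding all
  masses of a set at once, and only their values show that they differ by a single mass.
\<close>
definition adds_point_mass :: "complex measure \<Rightarrow> complex measure \<Rightarrow> real \<Rightarrow> complex \<Rightarrow> bool" where
  "adds_point_mass \<nu>' \<nu> t a \<longleftrightarrow> sets \<nu> = sets borel \<and> sets \<nu>' = sets borel \<and> 0 < t \<and>
     (\<forall>A\<in>sets borel. emeasure \<nu>' A = emeasure \<nu> A + ennreal t * indicator A a)"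

lemma adds_point_mass_insert:
  assumes "sets \<nu> = sets borel" "finite J" "j \<notin> J" "0 < t j"
  shows "adds_point_mass (measure_add \<nu> (point_mass_sum (insert j J) t z))
           (measure_add \<nu> (point_mass_sum J t z)) (t j) (z j)"
  using assms
  by (auto simp only: adds_point_mass_def sets_measure_add emeasure_measure_add
      emeasure_point_mass_sum sets_point_mass_sum sum.insert[OF assms(2,3)] ac_simps)

lemma measure_add_point_mass_sum_empty:
  "sets \<nu> = sets borel \<Longrightarrow> measure_add \<nu> (point_mass_sum {} t z) = \<nu>"
  by (rule measure_eqI) (auto simp: emeasure_measure_add emeasure_point_mass_sum)

lemma integral_adds_point_mass:
  fixes f :: "complex \<Rightarrow> complex"
  assumes ad: "adds_point_mass \<nu>' \<nu> t a" and fin: "finite_measure \<nu>"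
    and f: "integrable \<nu>' f"
  shows "integrable \<nu> f" and "integral\<^sup>L \<nu>' f = integral\<^sup>L \<nu> f + of_real t * f a"
proof -
  have s: "sets \<nu> = sets borel" "sets \<nu>' = sets borel" and t: "0 < t"
    and em: "\<And>A. A \<in> sets borel \<Longrightarrow> emeasure \<nu>' A = emeasure \<nu> A + ennreal t * indicator A a"
    using ad by (auto simp: adds_point_mass_def)
  note [measurable_cong] = s
  have sp: "space \<nu> = UNIV" "space \<nu>' = UNIV"
    using s by (auto dest: sets_eq_imp_space_eq)
  have le: "\<nu> \<le> \<nu>'"
  proof (subst le_measure)
    show "sets \<nu> = sets \<nu>'" using s by simp
    show "\<forall>A\<in>sets \<nu>. emeasure \<nu> A \<le> emeasure \<nu>' A" using em s by simp
  qed
  have int: "integrable \<nu> h" if "integrable \<nu>' h" for h :: "complex \<Rightarrow> complex"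
  proof (rule integrableI_bounded)
    show "h \<in> borel_measurable \<nu>" using borel_measurable_integrable[OF that] by measurable
    have "(\<integral>\<^sup>+ x. ennreal (norm (h x)) \<partial>\<nu>) \<le> (\<integral>\<^sup>+ x. ennreal (norm (h x)) \<partial>\<nu>')"
      using le s by (intro nn_integral_mono_measure) auto
    also have "\<dots> < \<infinity>" using that by (simp add: integrable_iff_bounded)
    finally show "(\<integral>\<^sup>+ x. ennreal (norm (h x)) \<partial>\<nu>) < \<infinity>" .
  qed
  show "integrable \<nu> f" using int f .
  show "integral\<^sup>L \<nu>' f = integral\<^sup>L \<nu> f + of_real t * f a"
    using f
  proof (induction rule: integrable_induct)
    case (base A c)
    interpret finite_measure \<nu> by (rule fin)
    have A: "A \<in> sets borel" using base s by simp
    have "measure \<nu>' A = measure \<nu> A + t * indicator A a"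
      using t unfolding measure_def em[OF A]
      by (simp add: enn2real_plus less_top[symmetric] ennreal_mult_eq_top_iff enn2real_mult
          split: split_indicator)
    then show ?case using base A s sp
      by (simp add: less_top[symmetric] scaleR_conv_of_real algebra_simps split: split_indicator)
  next
    case (add f g)
    then show ?case using int by (simp add: algebra_simps)
  next
    case (lim f s)
    have "(\<lambda>i. integral\<^sup>L \<nu>' (s i)) \<longlonglongrightarrow> integral\<^sup>L \<nu>' f"
      by (rule integral_dominated_convergence[where w="\<lambda>x. 2 * norm (f x)"])
         (use lim in auto)
    moreover have "(\<lambda>i. integral\<^sup>L \<nu> (s i) + of_real t * s i a) \<longlonglongrightarrow> integral\<^sup>L \<nu> f + of_real t * f a"
    proof (intro tendsto_intros integral_dominated_convergence[where w="\<lambda>x. 2 * norm (f x)"])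
      show "integrable \<nu> (\<lambda>x. 2 * norm (f x))" using int[OF lim.hyps(4)] by auto
    qed (use lim sp int in auto)
    ultimately show ?case unfolding lim.IH by (rule LIMSEQ_unique)
  qed
qed

section \<open>Orthonormal polynomials\<close>

text \<open>
  A polynomial is bounded on the disc that carries the measure.
\<close>
lemma integrable_poly_cnj_poly_bounded:
  assumes "finite_measure \<nu>" and s: "sets \<nu> = sets borel" and R: "AE z in \<nu>. cmod z \<le> R"
  shows "integrable \<nu> (\<lambda>z. poly p z * cnj (poly q z))"
proof -
  interpret finite_measure \<nu> by fact
  have "continuous_on (cball 0 R) (\<lambda>z. poly p z * cnj (poly q z))" by (intro continuous_intros)
  then have "bounded ((\<lambda>z. poly p z * cnj (poly q z)) ` cball 0 R)"
    by (intro compact_imp_bounded compact_continuous_image) auto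
  then obtain B where B: "\<And>z. cmod z \<le> R \<Longrightarrow> cmod (poly p z * cnj (poly q z)) \<le> B"
    unfolding bounded_iff by (metis imageI mem_cball_0)
  show ?thesis
  proof (rule integrable_const_bound)
    show "AE z in \<nu>. cmod (poly p z * cnj (poly q z)) \<le> B" using R by eventually_elim (rule B)
    have "continuous_on UNIV (\<lambda>z. poly p z * cnj (poly q z))" by (intro continuous_intros)
    then have "(\<lambda>z. poly p z * cnj (poly q z)) \<in> borel_measurable borel"
      by (rule borel_measurable_continuous_onI)
    then show "(\<lambda>z. poly p z * cnj (poly q z)) \<in> borel_measurable \<nu>"
      by (simp add: measurable_cong_sets[OF s refl])
  qed
qed

text \<open>
  The measures for which Gram-Schmidt orthogonalisation of the powers of \<open>z\<close> works.  Unlike the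
  assumption of a compact infinite support, these axioms are visibly inherited when a point mass is
  added.
\<close>
locale poly_measure = finite_measure \<nu> for \<nu> :: "complex measure" +
  assumes sets_eq: "sets \<nu> = sets borel"
    and AE_bounded: "\<exists>R. AE z in \<nu>. cmod z \<le> R"
    and definite: "(LINT z|\<nu>. poly q z * cnj (poly q z)) = 0 \<Longrightarrow> q = 0"

lemma (in poly_measure) integrable_poly_cnj_poly [simp]:
  "integrable \<nu> (\<lambda>z. poly p z * cnj (poly q z))"
  using integrable_poly_cnj_poly_bounded[OF finite_measure_axioms sets_eq] AE_bounded by blast

lemma poly_measure_adds_point_mass:
  assumes "poly_measure \<nu>" and ad: "adds_point_mass \<nu>' \<nu> t a"
  shows "poly_measure \<nu>'"
proof -
  interpret poly_measure \<nu> by fact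
  have s: "sets \<nu>' = sets borel" and t: "0 < t"
    and em: "\<And>A. A \<in> sets borel \<Longrightarrow> emeasure \<nu>' A = emeasure \<nu> A + ennreal t * indicator A a"
    using ad by (auto simp: adds_point_mass_def)
  have sp: "space \<nu>' = UNIV" using sets_eq_imp_space_eq[OF s] by simp
  have sp0: "space \<nu> = UNIV" using sets_eq_imp_space_eq[OF sets_eq] by simp
  interpret N: finite_measure \<nu>'
    by (rule finite_measureI) (simp add: sp em ennreal_mult_eq_top_iff emeasure_finite)
  have bd: "\<exists>R. AE z in \<nu>'. cmod z \<le> R"
  proof -
    obtain R where R: "AE z in \<nu>. cmod z \<le> R" using AE_bounded by auto
    define R' where "R' = max R (cmod a)"
    have "emeasure \<nu> {z. \<not> cmod z \<le> R'} = 0"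
    proof -
      have "AE z in \<nu>. cmod z \<le> R'" using R by eventually_elim (simp add: R'_def)
      then show ?thesis by (simp add: AE_iff_measurable[OF _ refl] sp0 sets_eq)
    qed
    then have "emeasure \<nu>' {z. \<not> cmod z \<le> R'} = 0"
      by (subst em) (auto simp: R'_def)
    then have "AE z in \<nu>'. cmod z \<le> R'"
      by (subst AE_iff_measurable[OF _ refl]) (auto simp: sp s)
    then show ?thesis ..
  qed
  have pre: "integrable \<nu>' (\<lambda>z. poly p z * cnj (poly q z))" for p q
    using integrable_poly_cnj_poly_bounded[OF N.finite_measure_axioms s] bd by blast
  show ?thesis
  proof unfold_locales
    fix q assume 0: "(LINT z|\<nu>'. poly q z * cnj (poly q z)) = 0"
    have sq: "(LINT z|\<nu>. poly q z * cnj (poly q z)) = of_real (LINT z|\<nu>. (cmod (poly q z))\<^sup>2)"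
      by (simp only: complex_norm_square[symmetric] integral_complex_of_real)
    have "of_real ((LINT z|\<nu>. (cmod (poly q z))\<^sup>2) + t * (cmod (poly q a))\<^sup>2) = (0 :: complex)"
      using integral_adds_point_mass(2)[OF ad _ pre, of q q] 0
      by (simp add: sq finite_measure_axioms complex_norm_square[symmetric] del: of_real_power)
    then have eq: "(LINT z|\<nu>. (cmod (poly q z))\<^sup>2) + t * (cmod (poly q a))\<^sup>2 = 0"
      by (simp only: of_real_eq_0_iff)
    moreover have "0 \<le> (LINT z|\<nu>. (cmod (poly q z))\<^sup>2)" by (intro integral_nonneg_AE) auto
    moreover have "0 \<le> t * (cmod (poly q a))\<^sup>2" using t by simp
    ultimately have "(LINT z|\<nu>. (cmod (poly q z))\<^sup>2) = 0" by linarith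
    then show "q = 0" by (intro definite) (simp add: sq)
  qed (use s bd in auto)
qed

text \<open>
  The condition on the coefficients of \<open>f\<close> says that \<open>f\<close> has degree less than \<open>n\<close> or is \<open>0\<close>; so
  it makes sense for \<open>n = 0\<close>, too.
\<close>
lemma poly_as_sum_of_degrees:
  assumes "\<And>i. i < n \<Longrightarrow> degree (p i) = i \<and> p i \<noteq> (0 :: complex poly)" and "\<And>k. n \<le> k \<Longrightarrow> coeff f k = 0"
  shows "\<exists>c. f = (\<Sum>i<n. smult (c i) (p i))"
  using assms
proof (induction n arbitrary: f)
  case 0
  then show ?case by (auto simp: poly_eq_iff)
next
  case (Suc n)
  define d where "d = coeff f n / coeff (p n) n"
  have pn: "coeff (p n) n \<noteq> 0" using Suc.prems(1)[of n] by (metis leading_coeff_0_iff lessI)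
  have "coeff (f - smult d (p n)) k = 0" if "n \<le> k" for k
  proof (cases "k = n")
    case True
    then show ?thesis using pn by (simp add: d_def)
  next
    case False
    then show ?thesis using that Suc.prems(1)[of n] Suc.prems(2)[of k] by (simp add: coeff_eq_0)
  qed
  then obtain c where c: "f - smult d (p n) = (\<Sum>i<n. smult (c i) (p i))"
    using Suc.IH[of "f - smult d (p n)"] Suc.prems(1) by auto
  have "f = (\<Sum>i<n. smult (c i) (p i)) + smult d (p n)" using c by (simp add: algebra_simps)
  also have "\<dots> = (\<Sum>i<Suc n. smult ((c(n := d)) i) (p i))" by simp
  finally show ?case by blast
qed

context poly_measure
begin

definition ip :: "complex poly \<Rightarrow> complex poly \<Rightarrow> complex" where
  "ip f g = (LINT z|\<nu>. poly f z * cnj (poly g z))"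

lemma ip_add_left: "ip (f + g) h = ip f h + ip g h"
  by (simp add: ip_def algebra_simps)

lemma ip_smult_left [simp]: "ip (smult c f) h = c * ip f h"
  by (simp add: ip_def mult.assoc)

lemma ip_diff_left: "ip (f - g) h = ip f h - ip g h"
  by (simp add: ip_def algebra_simps)

lemma ip_zero_left [simp]: "ip 0 h = 0"
  by (simp add: ip_def)

lemma ip_sum_left: "ip (\<Sum>i\<in>A. f i) h = (\<Sum>i\<in>A. ip (f i) h)"
  by (induction A rule: infinite_finite_induct) (simp_all add: ip_add_left)

lemma cnj_ip: "cnj (ip f g) = ip g f"
  using Bochner_Integration.integral_cnj[of \<nu> "\<lambda>z. poly f z * cnj (poly g z)"] by (simp add: ip_def mult.commute)

lemma ip_smult_right [simp]: "ip f (smult c g) = cnj c * ip f g"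
  using cnj_ip[of "smult c g" f] by (simp flip: cnj_ip[of g f])

lemma ip_sum_right: "ip h (\<Sum>i\<in>A. f i) = (\<Sum>i\<in>A. ip h (f i))"
  using arg_cong[OF ip_sum_left[of f A h], of cnj] by (simp add: cnj_ip)

lemma ip_diff_right: "ip h (f - g) = ip h f - ip h g"
  using arg_cong[OF ip_diff_left[of f g h], of cnj] by (simp add: cnj_ip)

lemma ip_self: "ip f f = of_real (LINT z|\<nu>. (cmod (poly f z))\<^sup>2)"
  unfolding ip_def by (simp only: complex_norm_square[symmetric] integral_complex_of_real)

lemma ip_self_eq_0_iff [simp]: "ip f f = 0 \<longleftrightarrow> f = 0"
  using definite[of f] by (auto simp: ip_def)

lemma norm_square_pos:
  assumes "f \<noteq> 0"
  shows "0 < (LINT z|\<nu>. (cmod (poly f z))\<^sup>2)"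
proof -
  have "0 \<le> (LINT z|\<nu>. (cmod (poly f z))\<^sup>2)" by (intro integral_nonneg_AE) auto
  moreover have "(LINT z|\<nu>. (cmod (poly f z))\<^sup>2) \<noteq> 0" using ip_self[of f] assms by auto
  ultimately show ?thesis by linarith
qed

text \<open>
  The \<open>n\<close>-th orthonormal polynomial, characterised by orthogonality to all polynomials of lower
  degree, without reference to the other members of the sequence.  So existence and uniqueness can
  be shown for each \<open>n\<close> separately, and a sequence of such polynomials is orthonormal however its
  members are chosen.
\<close>
definition unit_orthogonal :: "nat \<Rightarrow> complex poly \<Rightarrow> bool" where
  "unit_orthogonal n q \<longleftrightarrow> degree q = n \<and> (\<exists>c>0. lead_coeff q = complex_of_real c) \<and> ip q q = 1 \<and>
     (\<forall>f. (\<forall>k\<ge>n. coeff f k = 0) \<longrightarrow> ip q f = 0)"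

lemma unit_orthogonal_nonzero: "unit_orthogonal n q \<Longrightarrow> q \<noteq> 0"
  by (auto simp: unit_orthogonal_def)

text \<open>
  The combination \<open>h\<close> of \<open>q\<close> and \<open>r\<close> that cancels the leading terms has degree less than \<open>n\<close>,
  hence is orthogonal to both, hence to itself.
\<close>
lemma unit_orthogonal_unique:
  assumes q: "unit_orthogonal n q" and r: "unit_orthogonal n r"
  shows "q = r"
proof -
  obtain c d where cd: "c > 0" "d > 0" "lead_coeff q = complex_of_real c"
    "lead_coeff r = complex_of_real d" using assms by (auto simp: unit_orthogonal_def)
  have deg: "degree q = n" "degree r = n" using assms by (auto simp: unit_orthogonal_def)
  define h where "h = smult (of_real d) q - smult (of_real c) r"
  have "coeff h k = 0" if "n \<le> k" for k
    using that deg cd by (cases "k = n") (auto simp: h_def coeff_eq_0)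
  then have "ip q h = 0" "ip r h = 0" using assms by (auto simp: unit_orthogonal_def)
  moreover have "ip h h = of_real d * ip q h - of_real c * ip r h"
    by (subst (1) h_def) (simp add: ip_diff_left)
  ultimately have "ip h h = 0" by simp
  then have dq: "smult (of_real d) q = smult (of_real c) r" by (simp add: h_def)
  have "of_real (d * d) * ip q q = of_real (c * c) * ip r r"
    using arg_cong[OF dq, of "\<lambda>f. ip f f"] by (simp add: mult.assoc)
  moreover have "ip q q = 1" "ip r r = 1" using assms by (auto simp: unit_orthogonal_def)
  ultimately have "d * d = c * c" by (simp only: mult_1_right of_real_eq_iff)
  then have "d = c" using cd power2_eq_iff_nonneg[of d c] by (simp add: power2_eq_square)
  then have "coeff q k = coeff r k" for k
    using arg_cong[OF dq, of "\<lambda>f. coeff f k"] cd(1) by simp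
  then show ?thesis by (rule poly_eqI)
qed

lemma unit_orthogonal_ip:
  assumes "unit_orthogonal n q" "unit_orthogonal m r"
  shows "ip q r = (if n = m then 1 else 0)"
proof -
  have lower: "ip q r = 0" if "unit_orthogonal n q" "unit_orthogonal m r" "m < n" for n m q r
    using that by (auto simp: unit_orthogonal_def coeff_eq_0)
  show ?thesis
  proof (cases n m rule: linorder_cases)
    case less
    then have "cnj (ip r q) = 0" using lower[OF assms(2,1)] by simp
    then show ?thesis using less by (simp add: cnj_ip)
  next
    case equal
    then have "r = q" using unit_orthogonal_unique assms by blast
    then show ?thesis using assms(1) equal by (simp add: unit_orthogonal_def)
  next
    case greater
    then show ?thesis using lower[OF assms] by simp
  qed
qed

text \<open>
  One step of the Gram-Schmidt process.
\<close>
lemma unit_orthogonal_exists: "\<exists>q. unit_orthogonal n q"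
proof (induction n rule: less_induct)
  case (less n)
  then obtain p where p: "\<And>i. i < n \<Longrightarrow> unit_orthogonal i (p i)" by metis
  define f where "f = (\<Sum>i<n. smult (ip (monom 1 n) (p i)) (p i))"
  define h where "h = monom 1 n - f"
  have cf: "coeff f k = 0" if "n \<le> k" for k
    using that p by (auto simp: f_def coeff_sum unit_orthogonal_def intro!: sum.neutral coeff_eq_0)
  then have lc: "coeff h n = 1" by (simp add: h_def)
  have "degree h \<le> n" by (rule degree_le) (auto simp: h_def cf)
  then have deg: "degree h = n" using lc le_degree[of h n] by simp
  have h0: "h \<noteq> 0" using lc by auto
  define N where "N = (LINT z|\<nu>. (cmod (poly h z))\<^sup>2)"
  have N: "N > 0" unfolding N_def by (rule norm_square_pos[OF h0])
  have hp: "ip h (p j) = 0" if "j < n" for j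
  proof -
    have "ip f (p j) = (\<Sum>i<n. ip (monom 1 n) (p i) * (if i = j then 1 else 0))"
      unfolding f_def ip_sum_left using p that
      by (intro sum.cong) (auto simp: unit_orthogonal_ip[OF p p])
    also have "\<dots> = ip (monom 1 n) (p j)"
      using that by (simp add: if_distrib[of "(*) _"] sum.delta cong: if_cong)
    finally show ?thesis by (simp add: h_def ip_diff_left)
  qed
  have orth: "ip h g = 0" if cg: "\<forall>k\<ge>n. coeff g k = 0" for g
  proof -
    have "degree (p i) = i \<and> p i \<noteq> 0" if "i < n" for i
      using p[OF that] unit_orthogonal_nonzero[OF p[OF that]] by (simp add: unit_orthogonal_def)
    then obtain c where "g = (\<Sum>i<n. smult (c i) (p i))"
      using poly_as_sum_of_degrees[of n p g] cg by blast
    then show ?thesis by (simp add: ip_sum_right hp)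
  qed
  define q where "q = smult (of_real (1 / sqrt N)) h"
  have "ip h h = of_real N" by (simp only: ip_self N_def)
  then have "ip q q = of_real (1 / sqrt N * (1 / sqrt N * N))"
    by (simp only: q_def ip_smult_left ip_smult_right complex_cnj_complex_of_real of_real_mult)
  also have "1 / sqrt N * (1 / sqrt N * N) = 1" using N by (simp add: field_simps)
  finally have "ip q q = 1" by simp
  moreover have "\<exists>c>0. lead_coeff q = complex_of_real c"
    using N lc deg by (intro exI[of _ "1 / sqrt N"]) (simp add: q_def)
  ultimately have "unit_orthogonal n q"
    using orth deg N by (auto simp: unit_orthogonal_def q_def)
  then show ?case ..
qed

lemma unit_orthogonal_orthonormal_polys:
  assumes "orthonormal_polys \<nu> p"
  shows "unit_orthogonal n (p n)"
proof -
  note onp = assms[unfolded orthonormal_polys_def, folded ip_def]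
  have deg: "degree (p i) = i" for i using conjunct1[OF onp] by simp
  have lc: "\<exists>c>0. lead_coeff (p i) = complex_of_real c" for i using conjunct1[OF onp] by blast
  have ip: "ip (p i) (p j) = (if i = j then 1 else 0)" for i j using conjunct2[OF onp] by simp
  have nz: "p i \<noteq> 0" for i using lc[of i] by auto
  have "ip (p n) f = 0" if f: "\<forall>k\<ge>n. coeff f k = 0" for f
  proof -
    obtain c where "f = (\<Sum>i<n. smult (c i) (p i))"
      using poly_as_sum_of_degrees[of n p f] f deg nz by blast
    then show ?thesis by (simp add: ip_sum_right ip)
  qed
  moreover have "ip (p n) (p n) = 1" using ip by simp
  ultimately show ?thesis unfolding unit_orthogonal_def using deg lc by blast
qed

text \<open>
  This makes the definite description in the definition of \<open>orthonormal_poly\<close> meaningful.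
\<close>
lemma orthonormal_polys_orthonormal_poly: "orthonormal_polys \<nu> (orthonormal_poly \<nu>)"
proof -
  obtain p where p: "\<And>n. unit_orthogonal n (p n)" using unit_orthogonal_exists by metis
  have "orthonormal_polys \<nu> p"
    unfolding orthonormal_polys_def ip_def[symmetric]
    using p[unfolded unit_orthogonal_def] unit_orthogonal_ip[OF p p] by blast
  moreover have "r = p" if "orthonormal_polys \<nu> r" for r
    using unit_orthogonal_orthonormal_polys[OF that] unit_orthogonal_unique[OF _ p] by blast
  ultimately have "\<exists>!p. orthonormal_polys \<nu> p" by blast
  then show ?thesis unfolding orthonormal_poly_def by (rule theI')
qed

end

section \<open>The Christoffel-Darboux kernel\<close>

lemma cnj_CD_kernel: "cnj (CD_kernel \<nu> n z w) = CD_kernel \<nu> n w z"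
  by (simp add: CD_kernel_def mult.commute)

lemma CD_kernel_diag: "CD_kernel \<nu> n z z = of_real (\<Sum>j\<le>n. (cmod (poly (orthonormal_poly \<nu> j) z))\<^sup>2)"
  by (simp add: CD_kernel_def complex_norm_square flip: of_real_power)

context poly_measure
begin

abbreviation "P \<equiv> orthonormal_poly \<nu>"

lemma
  shows degree_orthonormal_poly: "degree (P n) = n"
    and orthonormal_poly_nonzero: "P n \<noteq> 0"
    and ip_orthonormal_poly: "ip (P n) (P m) = (if n = m then 1 else 0)"
proof -
  note op = orthonormal_polys_orthonormal_poly[unfolded orthonormal_polys_def, folded ip_def]
  show "degree (P n) = n" using conjunct1[OF op] by simp
  show "ip (P n) (P m) = (if n = m then 1 else 0)" using conjunct2[OF op] by simp
  obtain c where "c > 0" "lead_coeff (P n) = complex_of_real c" using conjunct1[OF op] by blast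
  then show "P n \<noteq> 0" by auto
qed

lemma orthonormal_expansion:
  assumes "degree f \<le> n"
  shows "f = (\<Sum>j\<le>n. smult (ip f (P j)) (P j))"
proof -
  obtain c where c: "f = (\<Sum>j<Suc n. smult (c j) (P j))"
    using poly_as_sum_of_degrees[of "Suc n" P f] assms degree_orthonormal_poly
      orthonormal_poly_nonzero by (auto simp: coeff_eq_0)
  have "ip f (P j) = c j" if "j \<le> n" for j
  proof -
    have "ip f (P j) = (\<Sum>i<Suc n. if i = j then c i else 0)"
      unfolding c ip_sum_left by (intro sum.cong) (auto simp: ip_orthonormal_poly)
    then show ?thesis using that by (simp add: sum.delta)
  qed
  then show ?thesis using c by (simp add: lessThan_Suc_atMost)
qed

text \<open>
  The kernel in its first variable as a polynomial, so that it can be paired with others.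
\<close>
definition kernel_poly :: "nat \<Rightarrow> complex \<Rightarrow> complex poly" where
  "kernel_poly n w = (\<Sum>j\<le>n. smult (cnj (poly (P j) w)) (P j))"

lemma poly_kernel_poly: "poly (kernel_poly n w) z = CD_kernel \<nu> n z w"
  by (simp add: kernel_poly_def CD_kernel_def poly_sum mult.commute)

lemma degree_kernel_poly: "degree (kernel_poly n w) \<le> n"
  unfolding kernel_poly_def
  by (intro degree_sum_le) (auto intro: order_trans[OF degree_smult_le] simp: degree_orthonormal_poly)

lemma kernel_poly_reproducing:
  assumes "degree f \<le> n"
  shows "ip f (kernel_poly n w) = poly f w"
proof -
  have "poly f w = (\<Sum>j\<le>n. ip f (P j) * poly (P j) w)"
    using arg_cong[OF orthonormal_expansion[OF assms], of "\<lambda>q. poly q w"] by (simp add: poly_sum)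
  then show ?thesis by (simp add: kernel_poly_def ip_sum_right mult.commute)
qed

lemma reproducing_kernel_unique:
  assumes "degree L \<le> n" and "\<And>f. degree f \<le> n \<Longrightarrow> ip f L = poly f w"
  shows "L = kernel_poly n w"
proof -
  have deg: "degree (L - kernel_poly n w) \<le> n"
    using assms(1) degree_kernel_poly by (rule degree_diff_le)
  have "ip (L - kernel_poly n w) (L - kernel_poly n w) = 0"
    using assms(2)[OF deg] kernel_poly_reproducing[OF deg] by (simp add: ip_diff_right)
  then show ?thesis by simp
qed

lemma CD_kernel_pos: "0 < Re (CD_kernel \<nu> n z z)"
proof -
  have "poly (P 0) z \<noteq> 0"
    using degree_orthonormal_poly[of 0] orthonormal_poly_nonzero[of 0] by (auto elim!: degree_eq_zeroE)
  then have "0 < (\<Sum>j\<le>n. (cmod (poly (P j) z))\<^sup>2)"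
    by (intro sum_pos2[where i=0]) auto
  then show ?thesis by (simp add: CD_kernel_diag)
qed

text \<open>
  The Cauchy-Schwarz inequality for the orthonormal expansion of \<open>f\<close>, evaluated at \<open>z\<close>.
\<close>
lemma CD_kernel_lower_bound:
  assumes "degree f \<le> n"
  shows "(cmod (poly f z))\<^sup>2 \<le> (LINT w|\<nu>. (cmod (poly f w))\<^sup>2) * (\<Sum>j\<le>n. (cmod (poly (P j) z))\<^sup>2)"
proof -
  let ?c = "\<lambda>j. cmod (ip f (P j))" and ?p = "\<lambda>j. cmod (poly (P j) z)"
  have f: "f = (\<Sum>j\<le>n. smult (ip f (P j)) (P j))" by (rule orthonormal_expansion[OF assms])
  have "ip f f = (\<Sum>j\<le>n. cnj (ip f (P j)) * ip f (P j))"
    using arg_cong[OF f, of "ip f"] by (simp add: ip_sum_right)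
  also have "\<dots> = of_real (\<Sum>j\<le>n. (?c j)\<^sup>2)"
    unfolding of_real_sum complex_norm_square by (simp add: mult.commute)
  finally have norm: "(LINT w|\<nu>. (cmod (poly f w))\<^sup>2) = (\<Sum>j\<le>n. (?c j)\<^sup>2)"
    unfolding ip_self by (simp only: of_real_eq_iff)
  have "poly f z = (\<Sum>j\<le>n. ip f (P j) * poly (P j) z)"
    using arg_cong[OF f, of "\<lambda>q. poly q z"] by (simp add: poly_sum)
  then have "cmod (poly f z) \<le> (\<Sum>j\<le>n. ?c j * ?p j)"
    by (metis (no_types, lifting) norm_mult norm_sum sum.cong)
  then have "(cmod (poly f z))\<^sup>2 \<le> (\<Sum>j\<le>n. ?c j * ?p j)\<^sup>2" by (intro power_mono) auto
  also have "\<dots> \<le> (\<Sum>j\<le>n. (?c j)\<^sup>2) * (\<Sum>j\<le>n. (?p j)\<^sup>2)" by (rule Cauchy_Schwarz_ineq_sum)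
  finally show ?thesis by (simp add: norm)
qed

end

text \<open>
  The right-hand side, as a polynomial \<open>L\<close> in \<open>z\<close>, has the reproducing property for \<open>\<nu>'\<close>: in
  the pairing with \<open>f\<close>, the correction \<open>cnj c * poly f a\<close> that is subtracted under \<open>\<nu>\<close> equals the
  contribution \<open>t * poly f a * cnj (poly L a)\<close> of the new mass.
\<close>
lemma CD_kernel_adds_point_mass:
  assumes "poly_measure \<nu>" and ad: "adds_point_mass \<nu>' \<nu> t a"
  shows "CD_kernel \<nu>' n z w = CD_kernel \<nu> n z w -
    of_real t * CD_kernel \<nu> n z a * CD_kernel \<nu> n a w / (1 + of_real t * CD_kernel \<nu> n a a)"
proof -
  interpret poly_measure \<nu> by fact
  interpret N: poly_measure \<nu>' using assms by (rule poly_measure_adds_point_mass)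
  have t: "t > 0" using ad by (simp add: adds_point_mass_def)
  define D where "D = 1 + of_real t * CD_kernel \<nu> n a a"
  have "Re D > 0" using t CD_kernel_pos[of n a] by (simp add: D_def add_pos_pos)
  then have D: "D \<noteq> 0" by auto
  have Dreal: "cnj D = D" by (simp add: D_def cnj_CD_kernel)
  define c where "c = of_real t * CD_kernel \<nu> n a w / D"
  define L where "L = kernel_poly n w - smult c (kernel_poly n a)"
  have ipN: "N.ip f g = ip f g + of_real t * (poly f a * cnj (poly g a))" for f g
    unfolding ip_def N.ip_def
    by (rule integral_adds_point_mass(2)[OF ad finite_measure_axioms]) simp
  have "N.ip f L = poly f w" if f: "degree f \<le> n" for f
  proof -
    have 1: "ip f L = poly f w - cnj c * poly f a"
      by (simp add: L_def ip_diff_right kernel_poly_reproducing[OF f])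
    have 2: "cnj (poly L a) = CD_kernel \<nu> n w a - cnj c * CD_kernel \<nu> n a a"
      by (simp add: L_def poly_kernel_poly cnj_CD_kernel)
    have c: "cnj c = of_real t * CD_kernel \<nu> n w a / D" by (simp add: c_def cnj_CD_kernel Dreal)
    have "cnj c * D = of_real t * CD_kernel \<nu> n w a" using D by (simp add: c)
    then have "of_real t * (CD_kernel \<nu> n w a - cnj c * CD_kernel \<nu> n a a) = cnj c"
      by (simp add: D_def algebra_simps)
    then have "N.ip f L = poly f w - cnj c * poly f a + poly f a * cnj c"
      unfolding ipN 1 2 by (simp add: mult.left_commute)
    then show ?thesis by simp
  qed
  moreover have "degree L \<le> n"
    unfolding L_def by (intro degree_diff_le degree_kernel_poly order_trans[OF degree_smult_le])
  ultimately have "L = N.kernel_poly n w" by (intro N.reproducing_kernel_unique) auto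
  then have "CD_kernel \<nu>' n z w = poly L z" by (simp add: N.poly_kernel_poly)
  also have "\<dots> = CD_kernel \<nu> n z w - c * CD_kernel \<nu> n z a" by (simp add: L_def poly_kernel_poly)
  finally show ?thesis by (simp add: c_def D_def mult_ac)
qed

section \<open>Consequences of the geometry of the support\<close>

text \<open>
  Off the support every point lies in a null set from a countable basis.
\<close>
lemma AE_in_measure_supp:
  assumes s: "sets \<nu> = sets borel"
  shows "AE z in \<nu>. z \<in> measure_supp \<nu>"
proof -
  obtain \<B> :: "complex set set" where \<B>: "countable \<B>" "topological_basis \<B>"
    using ex_countable_basis by blast
  have AE: "AE z in \<nu>. \<forall>U\<in>\<B>. emeasure \<nu> U = 0 \<longrightarrow> z \<notin> U"
  proof (subst AE_ball_countable[OF \<B>(1)], intro ballI)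
    fix U assume "U \<in> \<B>"
    then have "U \<in> sets \<nu>" using topological_basis_open[OF \<B>(2)] s by auto
    then show "AE z in \<nu>. emeasure \<nu> U = 0 \<longrightarrow> z \<notin> U"
      by (cases "emeasure \<nu> U = 0") (auto intro: AE_not_in)
  qed
  then show ?thesis
  proof eventually_elim
    case (elim z)
    show ?case unfolding measure_supp_def
    proof (intro CollectI allI impI)
      fix U :: "complex set" assume "open U" "z \<in> U"
      then obtain W where W: "W \<in> \<B>" "z \<in> W" "W \<subseteq> U" using topological_basisE[OF \<B>(2)] by metis
      have "emeasure \<nu> W \<noteq> 0" using elim W by auto
      moreover have "emeasure \<nu> W \<le> emeasure \<nu> U" using W \<open>open U\<close> s by (intro emeasure_mono) auto
      ultimately show "0 < emeasure \<nu> U" by (metis gr_zeroI le_zero_eq)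
    qed
  qed
qed

text \<open>
  If a polynomial has norm \<open>0\<close>, then the open set where it does not vanish is null.  So the
  support lies in its zero set, which is finite unless the polynomial is \<open>0\<close>.
\<close>
lemma poly_measure_infinite_support:
  assumes s: "sets \<nu> = sets borel" and fin: "finite_measure \<nu>"
    and comp: "compact (measure_supp \<nu>)" and inf: "infinite (measure_supp \<nu>)"
  shows "poly_measure \<nu>"
proof -
  interpret finite_measure \<nu> by fact
  have sp: "space \<nu> = UNIV" using sets_eq_imp_space_eq[OF s] by simp
  obtain R where R: "\<And>z. z \<in> measure_supp \<nu> \<Longrightarrow> cmod z \<le> R"
    using compact_imp_bounded[OF comp] unfolding bounded_iff by blast
  have bd: "AE z in \<nu>. cmod z \<le> R" using AE_in_measure_supp[OF s] by eventually_elim (rule R)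
  show ?thesis
  proof unfold_locales
    fix q assume 0: "(LINT z|\<nu>. poly q z * cnj (poly q z)) = 0"
    let ?f = "\<lambda>z. (cmod (poly q z))\<^sup>2"
    have eq: "(\<lambda>z. poly q z * cnj (poly q z)) = (\<lambda>z. complex_of_real (?f z))"
      by (rule ext) (rule complex_norm_square[symmetric])
    have int: "integrable \<nu> ?f"
      using integrable_poly_cnj_poly_bounded[OF fin s bd, of q q] unfolding eq
      by (simp only: complex_of_real_integrable_eq)
    have "(LINT z|\<nu>. ?f z) = 0" using 0 unfolding eq by (simp only: integral_complex_of_real of_real_eq_0_iff)
    then have "AE z in \<nu>. ?f z = 0" using integral_nonneg_eq_0_iff_AE[OF int] by simp
    then have AE: "AE z in \<nu>. poly q z = 0" by eventually_elim simp
    have op: "open {z. poly q z \<noteq> 0}" by (intro open_Collect_neq continuous_intros)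
    have "emeasure \<nu> {z. poly q z \<noteq> 0} = 0"
      using AE op by (subst (asm) AE_iff_measurable[OF _ refl]) (auto simp: sp s)
    then have "measure_supp \<nu> \<subseteq> {z. poly q z = 0}"
      using op unfolding measure_supp_def by fastforce
    then show "q = 0" using inf poly_roots_finite[of q] finite_subset by blast
  qed (use s bd in auto)
qed

text \<open>
  If \<open>\<bar>\<gamma>\<bar> \<ge> 1\<close>, then for each \<open>s > 1\<close> the \<open>n\<close>-th orthonormal polynomial at \<open>a\<close> is
  \<open>O(s ^ n)\<close>, so the diagonal kernel of degree \<open>n\<close> is \<open>O(n * s ^ (2 * n))\<close>.  But the \<open>k\<close>-th power of
  the peak polynomial \<open>q\<close> of degree \<open>d\<close> has degree at most \<open>k * d\<close>, value \<open>1\<close> at \<open>a\<close> and squared norm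
  \<open>O(c ^ (2 * k))\<close>, so the kernel of degree \<open>k * d\<close> is at least a multiple of \<open>c ^ (- 2 * k)\<close>.  These
  bounds contradict each other when \<open>s\<close> is so close to \<open>1\<close> that \<open>s ^ d * c < 1\<close>.
\<close>
lemma (in poly_measure) ratio_limit_less_one:
  assumes K: "AE w in \<nu>. w \<in> K" and pk: "peaks_over K a q c"
    and lim: "(\<lambda>n. poly (P n) a / poly (P (Suc n)) a) \<longlonglongrightarrow> \<gamma>"
  shows "cmod \<gamma> < 1"
proof (rule ccontr)
  assume \<gamma>: "\<not> cmod \<gamma> < 1"
  from pk have q: "poly q a = 1" "0 \<le> c" "c < 1" "\<And>w. w \<in> K \<Longrightarrow> cmod (poly q w) \<le> c"
    by (auto simp: peaks_over_def)
  define d where "d = degree q"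
  obtain s where s: "s > 1" "s ^ d * c < 1"
  proof -
    have "((\<lambda>s. s ^ d * c) \<longlongrightarrow> 1 ^ d * c) (at_right 1)" by (intro tendsto_intros)
    then have "\<forall>\<^sub>F s in at_right 1. s ^ d * c < 1" using q(3) by (intro order_tendstoD(2)) auto
    moreover have "\<forall>\<^sub>F s in at_right (1::real). 1 < s" by (rule eventually_at_right_less)
    ultimately have "\<forall>\<^sub>F s in at_right 1. 1 < s \<and> s ^ d * c < 1" by eventually_elim auto
    then show ?thesis using that eventually_happens[of _ "at_right (1::real)"] by auto
  qed
  let ?p = "\<lambda>n. cmod (poly (P n) a)"
  have "1 / s < cmod \<gamma>" using \<gamma> s by (simp add: field_simps) (smt (verit) mult_le_cancel_left1)
  then have "\<forall>\<^sub>F n in sequentially. 1 / s < cmod (poly (P n) a / poly (P (Suc n)) a)"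
    using order_tendstoD(1)[OF tendsto_norm[OF lim]] by blast
  then obtain N where N: "\<And>n. n \<ge> N \<Longrightarrow> 1 / s < ?p n / ?p (Suc n)"
    unfolding eventually_sequentially norm_divide by blast
  have step: "?p (Suc n) \<le> s * ?p n" if "n \<ge> N" for n
    using N[OF that] s by (cases "?p (Suc n) = 0") (auto simp: field_simps)
  define A where "A = (\<Sum>j\<le>N. ?p j)"
  have A0: "A \<ge> 0" by (simp add: A_def sum_nonneg)
  have growth: "?p n \<le> A * s ^ n" for n
  proof (induction n)
    case 0
    have "?p 0 \<le> A" unfolding A_def by (rule member_le_sum) auto
    then show ?case by simp
  next
    case (Suc n)
    show ?case
    proof (cases "n \<ge> N")
      case True
      have "?p (Suc n) \<le> s * ?p n" by (rule step[OF True])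
      also have "\<dots> \<le> s * (A * s ^ n)" using Suc s by (intro mult_left_mono) auto
      finally show ?thesis by (simp add: mult_ac)
    next
      case False
      then have "?p (Suc n) \<le> A" unfolding A_def by (intro member_le_sum) auto
      also have "\<dots> \<le> A * s ^ Suc n" using A0 s mult_left_mono[OF one_le_power[of s "Suc n"], of A] by simp
      finally show ?thesis .
    qed
  qed
  define x where "x = (s ^ d * c)\<^sup>2"
  have x: "0 \<le> x" "x < 1" using s q(2) unfolding x_def by (auto simp: power_less_one_iff abs_square_less_1)
  define M where "M = measure \<nu> (space \<nu>)"
  have le: "1 \<le> M * A\<^sup>2 * ((real k * real d + 1) * x ^ k)" for k
  proof -
    have "degree (q ^ k) \<le> k * d" using degree_power_le[of q k] by (simp add: d_def mult.commute)
    then have "(cmod (poly (q ^ k) a))\<^sup>2 \<le> 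
      (LINT w|\<nu>. (cmod (poly (q ^ k) w))\<^sup>2) * (\<Sum>j\<le>k * d. (?p j)\<^sup>2)"
      by (rule CD_kernel_lower_bound)
    moreover have "(LINT w|\<nu>. (cmod (poly (q ^ k) w))\<^sup>2) \<le> M * (c ^ k)\<^sup>2"
    proof -
      have "(LINT w|\<nu>. (cmod (poly (q ^ k) w))\<^sup>2) \<le> (LINT w|\<nu>. (c ^ k)\<^sup>2)"
      proof (rule integral_mono_AE)
        have "integrable \<nu> (\<lambda>z. complex_of_real ((cmod (poly (q ^ k) z))\<^sup>2))"
          unfolding complex_norm_square by (rule integrable_poly_cnj_poly)
        then show "integrable \<nu> (\<lambda>z. (cmod (poly (q ^ k) z))\<^sup>2)"
          by (simp only: complex_of_real_integrable_eq)
        show "AE w in \<nu>. (cmod (poly (q ^ k) w))\<^sup>2 \<le> (c ^ k)\<^sup>2" using K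
          by eventually_elim (auto simp: poly_power norm_power intro!: power_mono q(4))
      qed auto
      then show ?thesis by (simp add: M_def)
    qed
    moreover have "(\<Sum>j\<le>k * d. (?p j)\<^sup>2) \<le> (real k * real d + 1) * (A * s ^ (k * d))\<^sup>2"
    proof -
      have "(?p j)\<^sup>2 \<le> (A * s ^ (k * d))\<^sup>2" if "j \<in> {..k * d}" for j
      proof (rule power_mono)
        have "A * s ^ j \<le> A * s ^ (k * d)" using that s A0
          by (intro mult_left_mono power_increasing) auto
        then show "?p j \<le> A * s ^ (k * d)" using growth[of j] by simp
      qed auto
      from sum_mono[of "{..k * d}", OF this] show ?thesis by (simp add: algebra_simps)
    qed
    ultimately have "1 \<le> (M * (c ^ k)\<^sup>2) * ((real k * real d + 1) * (A * s ^ (k * d))\<^sup>2)"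
      using q(1) by (simp add: poly_power)
         (smt (verit) mult_mono sum_nonneg zero_le_power2 M_def measure_nonneg mult_nonneg_nonneg)
    also have "\<dots> = M * A\<^sup>2 * ((real k * real d + 1) * x ^ k)"
      by (simp add: x_def power_mult_distrib mult_ac flip: power_mult)
    finally show ?thesis .
  qed
  have "(\<lambda>k. M * A\<^sup>2 * (real d * (of_nat k * x ^ k) + x ^ k)) \<longlonglongrightarrow> M * A\<^sup>2 * (real d * 0 + 0)"
    using x by (intro tendsto_intros powser_times_n_limit_0 LIMSEQ_realpow_zero) auto
  then have "\<forall>\<^sub>F k in sequentially. M * A\<^sup>2 * (real d * (of_nat k * x ^ k) + x ^ k) < 1"
    by (rule order_tendstoD(2)) simp
  then obtain k where "M * A\<^sup>2 * (real d * (of_nat k * x ^ k) + x ^ k) < 1"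
    using eventually_happens[of _ sequentially] by auto
  then show False using le[of k] by (simp add: algebra_simps)
qed

section \<open>Limits of kernels in terms of the ratio limit\<close>

text \<open>
  The limit \<open>L = 1 / (1 - H)\<close> is the fixed point of \<open>u \<mapsto> 1 + u * H\<close>.  From an index \<open>M\<close> on, the
  distance of \<open>u\<close> to \<open>L\<close> contracts by a factor \<open>r < 1\<close> in each step, up to an error of at most
  \<open>e / 2 * (1 - r)\<close> that comes from replacing \<open>h n\<close> by \<open>H\<close>; these errors add up to at most \<open>e / 2\<close>.
\<close>
lemma uniform_limit_affine_recursion:
  fixes u h :: "nat \<Rightarrow> 'a \<Rightarrow> complex"
  assumes rec: "\<And>n x. n \<ge> N \<Longrightarrow> x \<in> X \<Longrightarrow> u (Suc n) x = 1 + u n x * h n x"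
    and h: "uniform_limit X h H sequentially"
    and H: "\<And>x. x \<in> X \<Longrightarrow> cmod (H x) \<le> q" and q: "0 \<le> q" "q < 1"
    and bd: "\<And>n. n \<ge> N \<Longrightarrow> \<exists>B. \<forall>x\<in>X. cmod (u n x) \<le> B"
  shows "uniform_limit X u (\<lambda>x. 1 / (1 - H x)) sequentially"
proof (rule uniform_limitI)
  fix e :: real assume e: "e > 0"
  define r where "r = (q + 1) / 2"
  have r: "0 < r" "r < 1" "q < r" using q by (auto simp: r_def)
  define L where "L x = 1 / (1 - H x)" for x
  define \<delta> where "\<delta> = min (r - q) (e / 2 * (1 - r) * (1 - q))"
  have "\<delta> > 0" using e r q by (simp add: \<delta>_def)
  moreover have "\<delta> \<le> r - q" unfolding \<delta>_def by (rule min.cobounded1)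
  moreover have "\<delta> \<le> e / 2 * (1 - r) * (1 - q)" unfolding \<delta>_def by (rule min.cobounded2)
  ultimately have \<delta>: "\<delta> > 0" "\<delta> \<le> r - q" "\<delta> \<le> e / 2 * (1 - r) * (1 - q)" .
  have "\<forall>\<^sub>F n in sequentially. \<forall>x\<in>X. dist (h n x) (H x) < \<delta>" using uniform_limitD[OF h \<delta>(1)] .
  then obtain M0 where M0: "\<And>n x. n \<ge> M0 \<Longrightarrow> x \<in> X \<Longrightarrow> cmod (h n x - H x) < \<delta>"
    unfolding eventually_sequentially dist_norm by blast
  define M where "M = max M0 N"
  have H1: "1 - q \<le> cmod (1 - H x)" if "x \<in> X" for x
    using norm_triangle_ineq2[of 1 "H x"] H[OF that] by simp
  have L: "cmod (L x) \<le> 1 / (1 - q)" if "x \<in> X" for x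
    using H1[OF that] q unfolding L_def norm_divide norm_one by (intro divide_left_mono mult_pos_pos) auto
  have fixp: "L x = 1 + L x * H x" if "x \<in> X" for x
  proof -
    have "1 - H x \<noteq> 0" using H1[OF that] q by auto
    then show ?thesis by (simp add: L_def field_simps)
  qed
  obtain B0 where B0: "\<And>x. x \<in> X \<Longrightarrow> cmod (u M x) \<le> B0" using bd[of M] by (auto simp: M_def)
  define B where "B = \<bar>B0\<bar> + 1 / (1 - q)"
  have err: "x \<in> X \<Longrightarrow> cmod (u (M + k) x - L x) \<le> r ^ k * B + e / 2" for k x
  proof (induction k)
    case 0
    have "cmod (u M x - L x) \<le> cmod (u M x) + cmod (L x)" by (rule norm_triangle_ineq4)
    then show ?case using B0[OF 0] L[OF 0] e by (simp add: B_def)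
  next
    case (Suc k)
    let ?n = "M + k"
    have hn: "cmod (h ?n x - H x) < \<delta>" using M0 Suc.prems by (simp add: M_def)
    have hr: "cmod (h ?n x) \<le> r"
      using norm_triangle_ineq[of "h ?n x - H x" "H x"] H[OF Suc.prems] hn \<delta>(2) by simp
    have "u (Suc ?n) x - L x = (1 + u ?n x * h ?n x) - (1 + L x * H x)"
      using rec[of ?n x] fixp[OF Suc.prems] Suc.prems by (simp add: M_def)
    also have "\<dots> = (u ?n x - L x) * h ?n x + L x * (h ?n x - H x)" by (simp add: algebra_simps)
    finally have "cmod (u (Suc ?n) x - L x) \<le> cmod (u ?n x - L x) * cmod (h ?n x) + cmod (L x) * cmod (h ?n x - H x)"
      by (metis norm_triangle_ineq norm_mult)
    also have "\<dots> \<le> (r ^ k * B + e / 2) * r + 1 / (1 - q) * (e / 2 * (1 - r) * (1 - q))"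
    proof (intro add_mono mult_mono)
      show "0 \<le> r ^ k * B + e / 2" using Suc norm_ge_zero order_trans by blast
    qed (use Suc hr hn \<delta> L q in auto)
    also have "\<dots> = r ^ Suc k * B + e / 2" using q by (simp add: field_simps)
    finally show ?case by simp
  qed
  have "(\<lambda>k. r ^ k * B) \<longlonglongrightarrow> 0 * B" using r by (intro tendsto_intros LIMSEQ_realpow_zero) auto
  then have "\<forall>\<^sub>F k in sequentially. r ^ k * B < e / 2" using e by (intro order_tendstoD(2)) auto
  then obtain k0 where k0: "\<And>k. k \<ge> k0 \<Longrightarrow> r ^ k * B < e / 2" unfolding eventually_sequentially by blast
  show "\<forall>\<^sub>F n in sequentially. \<forall>x\<in>X. dist (u n x) (1 / (1 - H x)) < e"
    unfolding eventually_sequentially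
  proof (intro exI[of _ "M + k0"] allI impI ballI)
    fix n x assume n: "M + k0 \<le> n" and x: "x \<in> X"
    have "k0 \<le> n - M" "M + (n - M) = n" using n by auto
    then show "dist (u n x) (1 / (1 - H x)) < e"
      using err[OF x, of "n - M"] k0[of "n - M"] by (simp add: dist_norm L_def)
  qed
qed

lemma uniform_limit_const_seq:
  "(a \<longlongrightarrow> L) F \<Longrightarrow> uniform_limit X (\<lambda>n x. a n) (\<lambda>x. L) F"
  by (auto simp: uniform_limit_iff tendsto_iff elim!: eventually_mono)

locale ratio_asymptotics = poly_measure +
  fixes \<Omega> :: "complex set" and g :: "complex \<Rightarrow> complex"
  assumes cont_g: "continuous_on \<Omega> g"
    and g_nonzero: "w \<in> \<Omega> \<Longrightarrow> g w \<noteq> 0"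
    and g_less_1: "w \<in> \<Omega> \<Longrightarrow> cmod (g w) < 1"
    and ratio_limit: "compact C \<Longrightarrow> C \<subseteq> \<Omega> \<Longrightarrow>
      uniform_limit C (\<lambda>n w. poly (P n) w / poly (P (Suc n)) w) g sequentially"
begin

lemma pole_free: "x \<in> \<Omega> \<Longrightarrow> y \<in> \<Omega> \<Longrightarrow> 1 - g x * cnj (g y) \<noteq> 0"
proof
  assume xy: "x \<in> \<Omega>" "y \<in> \<Omega>" and "1 - g x * cnj (g y) = 0"
  then have "cmod (g x * cnj (g y)) = 1" by simp
  moreover have "cmod (g x) * cmod (g y) < 1 * 1"
    using g_less_1[OF xy(1)] g_less_1[OF xy(2)] by (intro mult_strict_mono') auto
  ultimately show False by (simp add: norm_mult)
qed

lemma eventually_nonzero: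
  assumes C: "compact C" "C \<subseteq> \<Omega>"
  obtains N where "\<And>n w. N \<le> n \<Longrightarrow> w \<in> C \<Longrightarrow> poly (P n) w \<noteq> 0"
proof (cases "C = {}")
  case False
  have "continuous_on C (\<lambda>w. cmod (g w))"
    using cont_g C(2) by (intro continuous_intros) (rule continuous_on_subset)
  then obtain w0 where w0: "w0 \<in> C" "\<And>w. w \<in> C \<Longrightarrow> cmod (g w0) \<le> cmod (g w)"
    using continuous_attains_inf[OF C(1) False] by metis
  have "0 < cmod (g w0)" using g_nonzero w0(1) C(2) by auto
  from uniform_limitD[OF ratio_limit[OF C] this]
  obtain N where N: "\<And>n w. n \<ge> N \<Longrightarrow> w \<in> C \<Longrightarrow>
      dist (poly (P n) w / poly (P (Suc n)) w) (g w) < cmod (g w0)"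
    unfolding eventually_sequentially by blast
  have "poly (P n) w \<noteq> 0" if "n \<ge> N" "w \<in> C" for n w
    using N[OF that] w0(2)[OF that(2)] by (auto simp: dist_norm)
  then show ?thesis using that by blast
qed (use that in auto)

text \<open>
  Consecutive values have quotients of modulus less than some \<open>q < 1\<close>, eventually.
\<close>
lemma inverse_orthonormal_poly_tendsto_0:
  assumes a: "a \<in> \<Omega>"
  shows "(\<lambda>n. 1 / poly (P n) a) \<longlonglongrightarrow> 0"
proof -
  have Ca: "compact {a}" "{a} \<subseteq> \<Omega>" using a by auto
  obtain N where "\<And>n w. N \<le> n \<Longrightarrow> w \<in> {a} \<Longrightarrow> poly (P n) w \<noteq> 0"
    using eventually_nonzero[OF Ca] by blast
  then have N: "N \<le> n \<Longrightarrow> poly (P n) a \<noteq> 0" for n by simp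
  have "(\<lambda>n. poly (P n) a / poly (P (Suc n)) a) \<longlonglongrightarrow> g a"
    using ratio_limit[OF Ca] by (rule tendsto_uniform_limitI) simp
  then have lim: "(\<lambda>n. cmod (poly (P n) a / poly (P (Suc n)) a)) \<longlonglongrightarrow> cmod (g a)"
    by (rule tendsto_norm)
  obtain q where q: "cmod (g a) < q" "q < 1" using dense[OF g_less_1[OF a]] by blast
  obtain M where M: "\<And>n. n \<ge> M \<Longrightarrow> cmod (poly (P n) a / poly (P (Suc n)) a) < q"
    using order_tendstoD(2)[OF lim q(1)] unfolding eventually_sequentially by blast
  have "summable (\<lambda>n. 1 / poly (P n) a)"
  proof (rule summable_ratio_test[of q "max M N"])
    fix n assume n: "max M N \<le> n"
    then show "norm (1 / poly (P (Suc n)) a) \<le> q * norm (1 / poly (P n) a)"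
      using M[of n] N[of n] N[of "Suc n"] by (simp add: norm_divide field_simps)
  qed (rule q)
  then show ?thesis by (rule summable_LIMSEQ_zero)
qed

text \<open>
  Pairs as arguments, because uniform limits are taken over sets \<open>C \<times> C\<close>.  The kernel belongs to
  \<open>\<nu>'\<close>, the polynomials in the denominator to \<open>\<nu>\<close>: all kernels are compared on the same scale.
\<close>
definition scaled :: "complex measure \<Rightarrow> nat \<Rightarrow> complex \<times> complex \<Rightarrow> complex" where
  "scaled \<nu>' n x = CD_kernel \<nu>' n (fst x) (snd x) / (poly (P n) (fst x) * cnj (poly (P n) (snd x)))"

definition blaschke :: "('i \<Rightarrow> complex) \<Rightarrow> 'i set \<Rightarrow> complex \<Rightarrow> complex" where
  "blaschke z J w = (\<Prod>j\<in>J. (g w - g (z j)) / (1 - g w * cnj (g (z j))))"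

definition limit_kernel :: "('i \<Rightarrow> complex) \<Rightarrow> 'i set \<Rightarrow> complex \<times> complex \<Rightarrow> complex" where
  "limit_kernel z J x =
     blaschke z J (fst x) * cnj (blaschke z J (snd x)) / (1 - g (fst x) * cnj (g (snd x)))"

text \<open>
  The summand of index \<open>n + 1\<close> of the kernel is the denominator of its scaled version, so the
  scaled kernels satisfy an affine recursion.
\<close>
lemma scaled_CD_kernel_limit:
  assumes C: "compact C" "C \<subseteq> \<Omega>"
  shows "uniform_limit (C \<times> C) (scaled \<nu>) (\<lambda>x. 1 / (1 - g (fst x) * cnj (g (snd x)))) sequentially"
proof (cases "C = {}")
  case False
  obtain N where N: "\<And>n w. N \<le> n \<Longrightarrow> w \<in> C \<Longrightarrow> poly (P n) w \<noteq> 0"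
    using eventually_nonzero[OF C] by blast
  let ?r = "\<lambda>n w. poly (P n) w / poly (P (Suc n)) w"
  have contC: "continuous_on C g" using cont_g C(2) by (rule continuous_on_subset)
  then have contn: "continuous_on C (\<lambda>w. cmod (g w))" by (intro continuous_intros)
  obtain w0 where w0: "w0 \<in> C" "\<And>w. w \<in> C \<Longrightarrow> cmod (g w) \<le> cmod (g w0)"
    using continuous_attains_sup[OF C(1) False contn] by metis
  have w01: "cmod (g w0) < 1" using g_less_1 w0(1) C(2) by auto
  have bdg: "bounded (g ` C)" using contC C(1) by (intro compact_imp_bounded compact_continuous_image)
  have r: "uniform_limit C ?r g sequentially" by (rule ratio_limit[OF C])
  have r1: "uniform_limit (C \<times> C) (\<lambda>n x. ?r n (fst x)) (\<lambda>x. g (fst x)) sequentially"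
    by (rule uniform_limit_compose'[OF r]) auto
  have r2: "uniform_limit (C \<times> C) (\<lambda>n x. cnj (?r n (snd x))) (\<lambda>x. cnj (g (snd x))) sequentially"
    by (intro bounded_linear.uniform_limit[OF bounded_linear_cnj] uniform_limit_compose'[OF r]) auto
  show ?thesis
  proof (rule uniform_limit_affine_recursion[where q="cmod (g w0)" and N=N
        and h="\<lambda>n x. ?r n (fst x) * cnj (?r n (snd x))"])
    show "uniform_limit (C \<times> C) (\<lambda>n x. ?r n (fst x) * cnj (?r n (snd x)))
       (\<lambda>x. g (fst x) * cnj (g (snd x))) sequentially"
    proof (rule uniform_lim_mult[OF r1 r2])
      show "bounded ((\<lambda>x. g (fst x)) ` (C \<times> C))" by (rule bounded_subset[OF bdg]) auto
      have "bounded (cnj ` g ` C)" using bdg by (rule bounded_linear_image) (rule bounded_linear_cnj)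
      then show "bounded ((\<lambda>x. cnj (g (snd x))) ` (C \<times> C))" by (rule bounded_subset) auto
    qed
    show "cmod (g (fst x) * cnj (g (snd x))) \<le> cmod (g w0)" if "x \<in> C \<times> C" for x
    proof -
      have "cmod (g (fst x)) * cmod (g (snd x)) \<le> cmod (g w0) * 1"
        using w0(2)[of "fst x"] w0(2)[of "snd x"] that w01 by (intro mult_mono) auto
      then show ?thesis by (simp add: norm_mult)
    qed
  next
    fix n x assume n: "n \<ge> N" and "x \<in> C \<times> C"
    then obtain y w where x: "x = (y, w)" "y \<in> C" "w \<in> C" by auto
    have nz: "poly (P n) y \<noteq> 0" "poly (P n) w \<noteq> 0" "poly (P (Suc n)) y \<noteq> 0" "poly (P (Suc n)) w \<noteq> 0"
      using N n x by auto
    define p p' where "p = poly (P n) y * cnj (poly (P n) w)"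
      and "p' = poly (P (Suc n)) y * cnj (poly (P (Suc n)) w)"
    have p0: "p \<noteq> 0" "p' \<noteq> 0" using nz by (auto simp: p_def p'_def)
    have "scaled \<nu> (Suc n) x = (CD_kernel \<nu> n y w + p') / p'"
      by (simp add: scaled_def x CD_kernel_def p'_def)
    also have "\<dots> = 1 + CD_kernel \<nu> n y w / p * (p / p')"
      using p0 by (simp add: add_divide_distrib)
    also have "CD_kernel \<nu> n y w / p = scaled \<nu> n x" by (simp add: scaled_def x p_def)
    also have "p / p' = ?r n (fst x) * cnj (?r n (snd x))" by (simp add: x p_def p'_def)
    finally show "scaled \<nu> (Suc n) x = 1 + scaled \<nu> n x * (?r n (fst x) * cnj (?r n (snd x)))" .
  next
    fix n assume n: "n \<ge> N"
    have "continuous_on (C \<times> C) (scaled \<nu> n)"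
      unfolding scaled_def CD_kernel_def using N[OF n] by (intro continuous_intros) auto
    then have "bounded (scaled \<nu> n ` (C \<times> C))"
      using C(1) by (intro compact_imp_bounded compact_continuous_image compact_Times)
    then show "\<exists>B. \<forall>x\<in>C \<times> C. cmod (scaled \<nu> n x) \<le> B" unfolding bounded_iff by auto
  qed (use w01 in auto)
qed simp

lemma continuous_on_blaschke:
  assumes "z ` J \<subseteq> \<Omega>"
  shows "continuous_on \<Omega> (blaschke z J)"
  unfolding blaschke_def
  by (intro continuous_intros cont_g ballI pole_free) (use assms in auto)

lemma blaschke_nonzero:
  assumes "finite J" "z ` J \<subseteq> \<Omega>" "a \<in> \<Omega>" "\<And>j. j \<in> J \<Longrightarrow> g (z j) \<noteq> g a"
  shows "blaschke z J a \<noteq> 0"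
  using assms pole_free[OF assms(3)] by (force simp: blaschke_def)

lemma bounded_limit_kernel:
  assumes C: "compact C" "C \<subseteq> \<Omega>" and z: "z ` J \<subseteq> \<Omega>"
  shows "bounded (limit_kernel z J ` (C \<times> C))"
proof -
  have fst: "continuous_on (C \<times> C) (\<lambda>x. f (fst x))"
    and snd: "continuous_on (C \<times> C) (\<lambda>x. f (snd x))"
    if "continuous_on \<Omega> f" for f :: "complex \<Rightarrow> complex"
    using C(2) by (auto intro!: continuous_on_compose2[OF that] continuous_intros)
  have B: "continuous_on \<Omega> (blaschke z J)" using z by (rule continuous_on_blaschke)
  have "continuous_on (C \<times> C) (limit_kernel z J)"
    unfolding limit_kernel_def
    by (intro continuous_on_divide continuous_on_mult continuous_on_cnj continuous_on_diff
        continuous_on_const fst[OF B] snd[OF B] fst[OF cont_g] snd[OF cont_g] ballI pole_free)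
      (use C in auto)
  then show ?thesis using C(1) by (intro compact_imp_bounded compact_continuous_image compact_Times)
qed

text \<open>
  With \<open>B = cnj A'\<close> and \<open>d = cnj c\<close>, for \<open>A\<close>, \<open>A'\<close> and \<open>c\<close> in the unit disc, both sides are the
  reproducing kernel of the functions in the Hardy space that vanish at \<open>c\<close>: multiplication by the
  Blaschke factor of \<open>c\<close> maps the Hardy space isometrically onto them.  The algebra behind it is
  \<open>(A - c) * (B - d) = (1 - A * d) * (1 - c * B) - (1 - c * d) * (1 - A * B)\<close>.
\<close>
lemma pick_identity:
  fixes A B c d :: complex
  assumes "1 - A * B \<noteq> 0" "1 - A * d \<noteq> 0" "1 - c * B \<noteq> 0"
  shows "(A - c) / (1 - A * d) * ((B - d) / (1 - c * B)) / (1 - A * B) =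
     1 / (1 - A * B) - (1 - c * d) / ((1 - A * d) * (1 - c * B))"
proof -
  define u v where "u = 1 - A * B" and "v = (1 - A * d) * (1 - c * B)"
  have nz: "u \<noteq> 0" "v \<noteq> 0" using assms by (auto simp: u_def v_def)
  have key: "(A - c) * (B - d) = v - (1 - c * d) * u" unfolding u_def v_def by algebra
  have "(A - c) / (1 - A * d) * ((B - d) / (1 - c * B)) / (1 - A * B) = (A - c) * (B - d) / (v * u)"
    by (simp add: u_def v_def)
  also have "\<dots> = 1 / u - (1 - c * d) / v" unfolding key using nz by (simp add: diff_divide_distrib)
  finally show ?thesis by (simp only: u_def v_def)
qed

text \<open>
  The right-hand side is the limiting form of the rank-one formula for a mass at \<open>z j\<close>.  Once the
  Blaschke products for \<open>J\<close> are factored out of it, the preceding identity with \<open>c = g (z j)\<close>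
  remains.
\<close>
lemma limit_kernel_insert:
  assumes J: "finite J" "j \<notin> J" and a: "z j \<in> \<Omega>" and x: "y \<in> \<Omega>" "w \<in> \<Omega>"
    and B: "blaschke z J (z j) \<noteq> 0"
  shows "limit_kernel z (insert j J) (y, w) = limit_kernel z J (y, w) -
     limit_kernel z J (y, z j) * limit_kernel z J (z j, w) / limit_kernel z J (z j, z j)"
proof -
  define A B c d where "A = g y" and "B = cnj (g w)" and "c = g (z j)" and "d = cnj (g (z j))"
  define X Y b b' where "X = blaschke z J y" and "Y = cnj (blaschke z J w)"
    and "b = blaschke z J (z j)" and "b' = cnj (blaschke z J (z j))"
  note defs = A_def B_def c_def d_def X_def Y_def b_def b'_def
  have nz: "1 - A * B \<noteq> 0" "1 - A * d \<noteq> 0" "1 - c * B \<noteq> 0" "1 - c * d \<noteq> 0"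
    unfolding defs using pole_free x a by auto
  have b0: "b \<noteq> 0" "b' \<noteq> 0" using assms(6) by (auto simp: defs)
  have ins: "blaschke z (insert j J) v =
      (g v - g (z j)) / (1 - g v * cnj (g (z j))) * blaschke z J v" for v
    using J by (simp add: blaschke_def)
  have conj: "cnj ((g w - g (z j)) / (1 - g w * cnj (g (z j)))) = (B - d) / (1 - c * B)"
    by (simp add: B_def c_def d_def mult.commute)
  have "limit_kernel z (insert j J) (y, w) =
      ((A - c) / (1 - A * d) * X) * ((B - d) / (1 - c * B) * Y) / (1 - A * B)"
    unfolding limit_kernel_def fst_conv snd_conv ins complex_cnj_mult conj by (simp only: defs)
  also have "\<dots> = X * Y * ((A - c) / (1 - A * d) * ((B - d) / (1 - c * B)) / (1 - A * B))"
    by (simp add: mult_ac)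
  also have "\<dots> = X * Y / (1 - A * B) - X * Y * ((1 - c * d) / ((1 - A * d) * (1 - c * B)))"
    unfolding pick_identity[OF nz(1-3)] by (simp add: right_diff_distrib)
  also have "X * Y * ((1 - c * d) / ((1 - A * d) * (1 - c * B))) =
      (X * b' / (1 - A * d)) * (b * Y / (1 - c * B)) / (b * b' / (1 - c * d))"
    using b0 by simp
  finally show ?thesis by (simp add: limit_kernel_def defs)
qed

end

context ratio_asymptotics
begin

text \<open>
  In this form of the rank-one formula every term has a limit: the weight \<open>t\<close> occurs only in a
  term that tends to \<open>0\<close>.
\<close>
lemma scaled_adds_point_mass:
  assumes pm: "poly_measure \<nu>\<^sub>1" and ad: "adds_point_mass \<nu>\<^sub>2 \<nu>\<^sub>1 t a"
    and nz: "poly (P n) a \<noteq> 0"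
  shows "scaled \<nu>\<^sub>2 n (y, w) = scaled \<nu>\<^sub>1 n (y, w) - scaled \<nu>\<^sub>1 n (y, a) * scaled \<nu>\<^sub>1 n (a, w) *
    (1 / (1 / of_real t * (1 / poly (P n) a * cnj (1 / poly (P n) a)) + scaled \<nu>\<^sub>1 n (a, a)))"
proof -
  have t: "of_real t \<noteq> (0 :: complex)" using ad by (simp add: adds_point_mass_def)
  define K where "K = CD_kernel \<nu>\<^sub>1 n"
  define q r s s' where "q = poly (P n) y" and "r = cnj (poly (P n) w)"
    and "s = poly (P n) a" and "s' = cnj (poly (P n) a)"
  have s: "s \<noteq> 0" "s' \<noteq> 0" using nz by (auto simp: s_def s'_def)
  have eq: "1 / of_real t * (1 / s * (1 / s')) + K a a / (s * s') =
      (1 + of_real t * K a a) / (of_real t * (s * s'))"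
    using s t by (simp add: add_divide_distrib)
  have "scaled \<nu>\<^sub>2 n (y, w) = (K y w - of_real t * K y a * K a w / (1 + of_real t * K a a)) / (q * r)"
    by (simp add: scaled_def CD_kernel_adds_point_mass[OF pm ad] K_def q_def r_def)
  also have "\<dots> = K y w / (q * r) - (K y a / (q * s')) * (K a w / (s * r)) *
      (1 / ((1 + of_real t * K a a) / (of_real t * (s * s'))))"
    using s t by (simp add: diff_divide_distrib mult_ac)
  also have "\<dots> = K y w / (q * r) - (K y a / (q * s')) * (K a w / (s * r)) *
      (1 / (1 / of_real t * (1 / s * (1 / s')) + K a a / (s * s')))"
    by (simp only: eq)
  finally show ?thesis by (simp add: scaled_def K_def q_def r_def s_def s'_def)
qed

text \<open>
  By induction on the set of masses.  Compact sets are enlarged by the new point \<open>a\<close>, so that the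
  induction hypothesis covers the values of the kernel at \<open>(y, a)\<close>, \<open>(a, w)\<close> and \<open>(a, a)\<close>.
\<close>
proposition scaled_limit_point_masses:
  assumes "finite J" and "z ` J \<subseteq> \<Omega>" and "inj_on (\<lambda>j. g (z j)) J" and "\<And>j. j \<in> J \<Longrightarrow> 0 < t j"
  shows "poly_measure (measure_add \<nu> (point_mass_sum J t z)) \<and>
    (\<forall>C. compact C \<longrightarrow> C \<subseteq> \<Omega> \<longrightarrow>
      uniform_limit (C \<times> C) (scaled (measure_add \<nu> (point_mass_sum J t z))) (limit_kernel z J) sequentially)"
  using assms
proof (induction J rule: finite_induct)
  case empty
  have "limit_kernel z {} = (\<lambda>x. 1 / (1 - g (fst x) * cnj (g (snd x))))"
    by (simp add: limit_kernel_def blaschke_def fun_eq_iff)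
  then show ?case
    using scaled_CD_kernel_limit poly_measure_axioms
    by (simp add: measure_add_point_mass_sum_empty sets_eq)
next
  case (insert j J)
  define \<nu>1 where "\<nu>1 = measure_add \<nu> (point_mass_sum J t z)"
  define \<nu>2 where "\<nu>2 = measure_add \<nu> (point_mass_sum (insert j J) t z)"
  define a where "a = z j"
  have ad: "adds_point_mass \<nu>2 \<nu>1 (t j) a"
    unfolding \<nu>1_def \<nu>2_def a_def
    by (rule adds_point_mass_insert) (use insert sets_eq in auto)
  have IH: "poly_measure \<nu>1"
    "\<And>C. compact C \<Longrightarrow> C \<subseteq> \<Omega> \<Longrightarrow> uniform_limit (C \<times> C) (scaled \<nu>1) (limit_kernel z J) sequentially"
    using insert.IH insert.prems unfolding \<nu>1_def by (auto simp: inj_on_insert)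
  have a: "a \<in> \<Omega>" and zJ: "z ` J \<subseteq> \<Omega>" using insert.prems by (auto simp: a_def)
  have B: "blaschke z J a \<noteq> 0"
    using insert.prems insert.hyps a zJ
    by (intro blaschke_nonzero) (auto simp: a_def inj_on_def)
  then have lam: "limit_kernel z J (a, a) \<noteq> 0" using pole_free[OF a a] by (simp add: limit_kernel_def)
  have "uniform_limit (C \<times> C) (scaled \<nu>2) (limit_kernel z (insert j J)) sequentially"
    if C: "compact C" "C \<subseteq> \<Omega>" for C
  proof -
    have C': "compact (insert a C)" "insert a C \<subseteq> \<Omega>" using C a by auto
    let ?X = "insert a C \<times> insert a C"
    let ?\<tau> = "\<lambda>n. 1 / of_real (t j) * (1 / poly (P n) a * cnj (1 / poly (P n) a)) + scaled \<nu>1 n (a, a)"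
    have U: "uniform_limit ?X (scaled \<nu>1) (limit_kernel z J) sequentially" by (rule IH(2)[OF C'])
    have bd: "bounded (limit_kernel z J ` ?X)" by (rule bounded_limit_kernel[OF C' zJ])
    have u0: "uniform_limit (C \<times> C) (scaled \<nu>1) (limit_kernel z J) sequentially"
      by (rule IH(2)[OF C])
    have u1: "uniform_limit (C \<times> C) (\<lambda>n x. scaled \<nu>1 n (fst x, a)) (\<lambda>x. limit_kernel z J (fst x, a)) sequentially"
      by (rule uniform_limit_compose'[OF U]) auto
    have u2: "uniform_limit (C \<times> C) (\<lambda>n x. scaled \<nu>1 n (a, snd x)) (\<lambda>x. limit_kernel z J (a, snd x)) sequentially"
      by (rule uniform_limit_compose'[OF U]) auto
    have b1: "bounded ((\<lambda>x. limit_kernel z J (fst x, a)) ` (C \<times> C))"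
      by (rule bounded_subset[OF bd]) auto
    have b2: "bounded ((\<lambda>x. limit_kernel z J (a, snd x)) ` (C \<times> C))"
      by (rule bounded_subset[OF bd]) auto
    have b12: "bounded ((\<lambda>x. limit_kernel z J (fst x, a) * limit_kernel z J (a, snd x)) ` (C \<times> C))"
    proof -
      obtain R where R: "\<And>x. x \<in> ?X \<Longrightarrow> cmod (limit_kernel z J x) \<le> R"
        using bd unfolding bounded_iff by blast
      have "cmod (limit_kernel z J (fst x, a) * limit_kernel z J (a, snd x)) \<le> R * R"
        if x: "x \<in> C \<times> C" for x
        unfolding norm_mult
      proof (intro mult_mono)
        show r: "cmod (limit_kernel z J (fst x, a)) \<le> R" using x by (intro R) auto
        show "cmod (limit_kernel z J (a, snd x)) \<le> R" using x by (intro R) auto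
        show "0 \<le> R" using r norm_ge_zero order_trans by blast
      qed simp
      then show ?thesis unfolding bounded_iff by blast
    qed
    have "(\<lambda>n. ?\<tau> n) \<longlonglongrightarrow> 1 / of_real (t j) * (0 * cnj 0) + limit_kernel z J (a, a)"
      by (intro tendsto_intros inverse_orthonormal_poly_tendsto_0 a tendsto_uniform_limitI[OF U]) auto
    then have "(\<lambda>n. 1 / ?\<tau> n) \<longlonglongrightarrow> 1 / limit_kernel z J (a, a)"
      using lam by (intro tendsto_intros) auto
    then have u3: "uniform_limit (C \<times> C) (\<lambda>n x. 1 / ?\<tau> n) (\<lambda>x. 1 / limit_kernel z J (a, a)) sequentially"
      by (rule uniform_limit_const_seq)
    have u: "uniform_limit (C \<times> C)
      (\<lambda>n x. scaled \<nu>1 n x - scaled \<nu>1 n (fst x, a) * scaled \<nu>1 n (a, snd x) * (1 / ?\<tau> n))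
      (\<lambda>x. limit_kernel z J x - limit_kernel z J (fst x, a) * limit_kernel z J (a, snd x) *
         (1 / limit_kernel z J (a, a))) sequentially"
      by (intro uniform_limit_minus u0 uniform_lim_mult[OF uniform_lim_mult[OF u1 u2 b1 b2] u3 b12])
        (auto simp: bounded_iff)
    obtain N where "\<And>n w. N \<le> n \<Longrightarrow> w \<in> insert a C \<Longrightarrow> poly (P n) w \<noteq> 0"
      using eventually_nonzero[OF C'] by blast
    then have N: "N \<le> n \<Longrightarrow> poly (P n) a \<noteq> 0" for n by simp
    have ev: "\<forall>\<^sub>F n in sequentially. \<forall>x\<in>C \<times> C.
      scaled \<nu>1 n x - scaled \<nu>1 n (fst x, a) * scaled \<nu>1 n (a, snd x) * (1 / ?\<tau> n) = scaled \<nu>2 n x"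
      using eventually_ge_at_top[of N]
    proof eventually_elim
      case (elim n)
      have "scaled \<nu>2 n x =
          scaled \<nu>1 n x - scaled \<nu>1 n (fst x, a) * scaled \<nu>1 n (a, snd x) * (1 / ?\<tau> n)" for x
        using scaled_adds_point_mass[OF IH(1) ad N[OF elim], of "fst x" "snd x"]
        by (simp only: prod.collapse)
      then show ?case by (intro ballI) (rule sym)
    qed
    have lim: "limit_kernel z (insert j J) x = limit_kernel z J x -
        limit_kernel z J (fst x, a) * limit_kernel z J (a, snd x) * (1 / limit_kernel z J (a, a))"
      if x: "x \<in> C \<times> C" for x
    proof -
      have x': "fst x \<in> \<Omega>" "snd x \<in> \<Omega>" using x C(2) by auto
      show ?thesis
        using limit_kernel_insert[OF insert.hyps(1,2) a[unfolded a_def] x' B[unfolded a_def]]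
        by (simp add: a_def)
    qed
    show ?thesis
      by (rule uniform_limit_cong[THEN iffD1, rotated 2, OF u ev]) (rule lim[symmetric])
  qed
  moreover have "poly_measure \<nu>2" by (rule poly_measure_adds_point_mass[OF IH(1) ad])
  ultimately show ?case unfolding \<nu>2_def by blast
qed

text \<open>
  On the diagonal the scaling factors of numerator and denominator cancel.
\<close>
proposition CD_kernel_ratio_limit:
  assumes J: "finite J" "z ` J \<subseteq> \<Omega>" "inj_on (\<lambda>j. g (z j)) J" "\<And>j. j \<in> J \<Longrightarrow> 0 < t j"
    and C: "compact C" "C \<subseteq> \<Omega>"
  shows "uniform_limit C
    (\<lambda>n w. CD_kernel (measure_add \<nu> (point_mass_sum J t z)) n w w / CD_kernel \<nu> n w w)
    (\<lambda>w. complex_of_real ((cmod (blaschke z J w))\<^sup>2)) sequentially"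
proof -
  let ?\<nu> = "measure_add \<nu> (point_mass_sum J t z)"
  have num: "uniform_limit C (\<lambda>n w. scaled ?\<nu> n (w, w)) (\<lambda>w. limit_kernel z J (w, w)) sequentially"
    using scaled_limit_point_masses[where t=t, OF J] C
    by (intro uniform_limit_compose'[where A="C \<times> C" and f="scaled ?\<nu>" and g="limit_kernel z J"
          and h="\<lambda>w. (w, w)"]) auto
  have den: "uniform_limit C (\<lambda>n w. scaled \<nu> n (w, w)) (\<lambda>w. 1 / (1 - g w * cnj (g w))) sequentially"
    using uniform_limit_compose'[OF scaled_CD_kernel_limit[OF C], where h="\<lambda>w. (w, w)" and B=C] by auto
  have bd: "bounded ((\<lambda>w. limit_kernel z J (w, w)) ` C)"
    by (rule bounded_subset[OF bounded_limit_kernel[OF C J(2)]]) auto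
  \<comment> \<open>the limit of the denominators stays away from \<open>0\<close>, which makes the limit of the quotients uniform\<close>
  have low: "1 / 2 \<le> cmod (1 / (1 - g w * cnj (g w)))" if "w \<in> C" for w
  proof -
    have g1: "cmod (g w) < 1" using g_less_1 that C(2) by auto
    have "cmod (1 - g w * cnj (g w)) \<le> 1 + cmod (g w) * cmod (g w)"
      using norm_triangle_ineq4[of 1 "g w * cnj (g w)"] by (simp add: norm_mult)
    also have "\<dots> \<le> 2" using g1 mult_le_one[of "cmod (g w)" "cmod (g w)"] by simp
    finally have "cmod (1 - g w * cnj (g w)) \<le> 2" .
    moreover have "1 - g w * cnj (g w) \<noteq> 0" using pole_free that C(2) by auto
    ultimately show ?thesis by (simp add: norm_divide divide_simps)
  qed
  have quot: "uniform_limit C (\<lambda>n w. scaled ?\<nu> n (w, w) / scaled \<nu> n (w, w))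
      (\<lambda>w. limit_kernel z J (w, w) / (1 / (1 - g w * cnj (g w)))) sequentially"
    by (rule uniform_lim_divide[OF num den bd low]) auto
  obtain N where N: "\<And>n w. N \<le> n \<Longrightarrow> w \<in> C \<Longrightarrow> poly (P n) w \<noteq> 0"
    using eventually_nonzero[OF C] by blast
  have ev: "\<forall>\<^sub>F n in sequentially. \<forall>w\<in>C.
      scaled ?\<nu> n (w, w) / scaled \<nu> n (w, w) = CD_kernel ?\<nu> n w w / CD_kernel \<nu> n w w"
    using eventually_ge_at_top[of N] by eventually_elim (simp add: scaled_def N)
  have lim: "limit_kernel z J (w, w) / (1 / (1 - g w * cnj (g w))) =
      complex_of_real ((cmod (blaschke z J w))\<^sup>2)" if "w \<in> C" for w
    using pole_free[of w w] that C(2) unfolding complex_norm_square by (auto simp: limit_kernel_def)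
  show ?thesis by (rule uniform_limit_cong[THEN iffD1, rotated 2, OF quot ev]) (rule lim)
qed

text \<open>
  The mass at \<open>z m\<close> is the last one to be added, which gives the exact error term
  \<open>\<epsilon> n = - 1 / (1 + t m * k1 n)\<close>; the limit of the kernel ratio, which is positive at \<open>z m\<close> when that
  mass is left out, compares \<open>k1\<close> with the kernel of \<open>\<nu>\<close>.
\<close>
proposition CD_kernel_at_point_mass:
  assumes J: "finite J" "z ` J \<subseteq> \<Omega>" "inj_on (\<lambda>j. g (z j)) J" "\<And>j. j \<in> J \<Longrightarrow> 0 < t j" and m: "m \<in> J"
  shows "\<exists>\<epsilon>. \<epsilon> \<in> O(\<lambda>n. 1 / CD_kernel \<nu> n (z m) (z m)) \<and>
    (\<forall>n. CD_kernel (measure_add \<nu> (point_mass_sum J t z)) n (z m) (z m)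
       = complex_of_real (1 / t m) * (1 + \<epsilon> n))"
proof -
  define I where "I = J - {m}"
  define a where "a = z m"
  define \<nu>1 where "\<nu>1 = measure_add \<nu> (point_mass_sum I t z)"
  define \<nu>2 where "\<nu>2 = measure_add \<nu> (point_mass_sum J t z)"
  have I: "finite I" "z ` I \<subseteq> \<Omega>" "inj_on (\<lambda>j. g (z j)) I" "\<And>j. j \<in> I \<Longrightarrow> 0 < t j"
    using J by (auto simp: I_def inj_on_def)
  have a: "a \<in> \<Omega>" using J m by (auto simp: a_def)
  have t: "t m > 0" using J m by auto
  have JI: "J = insert m I" "m \<notin> I" using m by (auto simp: I_def)
  have ad: "adds_point_mass \<nu>2 \<nu>1 (t m) a"
    unfolding \<nu>1_def \<nu>2_def a_def JI(1)
    by (rule adds_point_mass_insert) (use I JI t sets_eq in auto)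
  have pm: "poly_measure \<nu>1" using scaled_limit_point_masses[where t=t, OF I] by (simp add: \<nu>1_def)
  define k where "k n = Re (CD_kernel \<nu> n a a)" for n
  define k1 where "k1 n = Re (CD_kernel \<nu>1 n a a)" for n
  have k: "CD_kernel \<nu> n a a = of_real (k n)" "0 < k n" for n
    using CD_kernel_pos[of n a] by (auto simp: k_def CD_kernel_diag simp del: of_real_sum)
  have k1: "CD_kernel \<nu>1 n a a = of_real (k1 n)" "0 < k1 n" for n
    using poly_measure.CD_kernel_pos[OF pm, of n a] by (auto simp: k1_def CD_kernel_diag simp del: of_real_sum)
  define \<epsilon> where "\<epsilon> n = - complex_of_real (1 / (1 + t m * k1 n))" for n
  have "CD_kernel \<nu>2 n a a = complex_of_real (1 / t m) * (1 + \<epsilon> n)" for n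
  proof -
    have "1 + t m * k1 n > 0" using t k1(2)[of n] by (simp add: add_pos_pos)
    then have "k1 n - t m * k1 n * k1 n / (1 + t m * k1 n) = 1 / t m * (1 + - (1 / (1 + t m * k1 n)))"
      using t by (simp add: field_simps)
    from arg_cong[OF this, of complex_of_real] show ?thesis
      unfolding CD_kernel_adds_point_mass[OF pm ad] k1 \<epsilon>_def by simp
  qed
  moreover have "\<epsilon> \<in> O(\<lambda>n. 1 / CD_kernel \<nu> n a a)"
  proof -
    define b where "b = (cmod (blaschke z I a))\<^sup>2"
    have "blaschke z I a \<noteq> 0"
      using J JI a I by (intro blaschke_nonzero) (auto simp: a_def inj_on_def)
    then have b: "b > 0" by (simp add: b_def)
    have "uniform_limit {a} (\<lambda>n w. CD_kernel \<nu>1 n w w / CD_kernel \<nu> n w w)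
        (\<lambda>w. complex_of_real ((cmod (blaschke z I w))\<^sup>2)) sequentially"
      using CD_kernel_ratio_limit[where t=t and C="{a}", OF I] a unfolding \<nu>1_def by simp
    then have "(\<lambda>n. CD_kernel \<nu>1 n a a / CD_kernel \<nu> n a a) \<longlonglongrightarrow> complex_of_real b"
      unfolding b_def by (rule tendsto_uniform_limitI) simp
    then have "(\<lambda>n. k1 n / k n) \<longlonglongrightarrow> b"
      unfolding k k1 of_real_divide[symmetric] by (simp only: tendsto_of_real_iff)
    then have "\<forall>\<^sub>F n in sequentially. b / 2 < k1 n / k n" using b by (intro order_tendstoD(1)) auto
    then have "\<forall>\<^sub>F n in sequentially. norm (\<epsilon> n) \<le> 2 / (t m * b) * norm (1 / CD_kernel \<nu> n a a)"
    proof eventually_elim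
      case (elim n)
      have "b / 2 * k n < k1 n" using elim k(2)[of n] by (simp add: field_simps)
      then have "t m * (b / 2 * k n) \<le> 1 + t m * k1 n" using t by (intro add_increasing mult_left_mono) auto
      then have "1 / (1 + t m * k1 n) \<le> 1 / (t m * (b / 2 * k n))"
        using t b k(2)[of n] k1(2)[of n] by (intro divide_left_mono mult_pos_pos add_pos_pos) auto
      moreover have "norm (\<epsilon> n) = 1 / (1 + t m * k1 n)"
        unfolding \<epsilon>_def norm_minus_cancel norm_of_real using t k1(2)[of n] by simp
      moreover have "norm (1 / CD_kernel \<nu> n a a) = 1 / k n" using k[of n] by (simp add: norm_divide)
      ultimately show ?case by simp
    qed
    then show ?thesis by (rule bigoI)
  qed
  ultimately show ?thesis unfolding a_def \<nu>2_def by blast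
qed

end

theorem corollary5p4:
  fixes \<mu> :: "complex measure"
    and V \<Omega> :: "complex set"
    and g :: "complex \<Rightarrow> complex"
    and l :: nat
    and z :: "nat \<Rightarrow> complex"
    and t :: "nat \<Rightarrow> real"
  defines "\<sigma> \<equiv> point_mass_sum {1..l} t z"
  assumes "sets \<mu> = sets borel"
    and "finite_measure \<mu>"
    and "compact (measure_supp \<mu>)"
    and "infinite (measure_supp \<mu>)"
    and "V \<in> components (- measure_supp \<mu>)" and "\<not> bounded V"
    and "\<Omega> \<subseteq> V" and "open \<Omega>" and "connected \<Omega>" and "\<Omega> \<noteq> {}"
    and "g analytic_on \<Omega>"
    and "\<And>w. w \<in> \<Omega> \<Longrightarrow> g w \<noteq> 0"
    and "\<And>C. compact C \<Longrightarrow> C \<subseteq> \<Omega> \<Longrightarrow>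
           uniform_limit C
             (\<lambda>n w. poly (orthonormal_poly \<mu> n) w / poly (orthonormal_poly \<mu> (Suc n)) w)
             g sequentially"
    and "\<And>j. j \<in> {1..l} \<Longrightarrow> z j \<in> \<Omega>"
    and "inj_on (\<lambda>j. g (z j)) {1..l}"
    and "\<And>j. j \<in> {1..l} \<Longrightarrow> t j > 0"
  shows "(\<forall>C. compact C \<longrightarrow> C \<subseteq> \<Omega> \<longrightarrow>
            uniform_limit C
              (\<lambda>n w. CD_kernel (measure_add \<mu> \<sigma>) n w w / CD_kernel \<mu> n w w)
              (\<lambda>w. complex_of_real
                ((cmod (\<Prod>j=1..l. (g w - g (z j)) / (1 - g w * cnj (g (z j)))))\<^sup>2))
              sequentially) \<and>
         (\<forall>m\<in>{1..l}. \<exists>\<epsilon>. \<epsilon> \<in> O[sequentially](\<lambda>n. 1 / CD_kernel \<mu> n (z m) (z m)) \<and>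
            (\<forall>n. CD_kernel (measure_add \<mu> \<sigma>) n (z m) (z m)
                   = complex_of_real (1 / t m) * (1 + \<epsilon> n)))"
proof -
  interpret poly_measure \<mu> by (rule poly_measure_infinite_support) fact+
  interpret ratio_asymptotics \<mu> \<Omega> g
  proof unfold_locales
    show "continuous_on \<Omega> g"
      using assms(12) by (intro holomorphic_on_imp_continuous_on analytic_imp_holomorphic)
    fix w assume w: "w \<in> \<Omega>"
    have "w \<in> V" using w assms(8) by auto
    then obtain q c where "peaks_over (measure_supp \<mu>) w q c"
      using peak_polynomial_unbounded_component[OF assms(4,6,7)] by blast
    then show "cmod (g w) < 1"
    proof (rule ratio_limit_less_one[OF AE_in_measure_supp[OF assms(2)]])
      show "(\<lambda>n. poly (P n) w / poly (P (Suc n)) w) \<longlonglongrightarrow> g w"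
        using w by (intro tendsto_uniform_limitI[OF assms(14)[of "{w}"]]) auto
    qed
  qed (use assms in auto)
  have z: "z ` {1..l} \<subseteq> \<Omega>" using assms(15) by blast
  note J = finite_atLeastAtMost[of 1 l] z assms(16,17)
  show ?thesis
  proof (intro conjI allI impI ballI)
    fix C assume "compact C" "C \<subseteq> \<Omega>"
    then show "uniform_limit C
        (\<lambda>n w. CD_kernel (measure_add \<mu> \<sigma>) n w w / CD_kernel \<mu> n w w)
        (\<lambda>w. complex_of_real
          ((cmod (\<Prod>j=1..l. (g w - g (z j)) / (1 - g w * cnj (g (z j)))))\<^sup>2)) sequentially"
      using CD_kernel_ratio_limit[where t=t, OF J] unfolding \<sigma>_def blaschke_def by blast
  next
    fix m assume m: "m \<in> {1..l}"
    show "\<exists>\<epsilon>. \<epsilon> \<in> O(\<lambda>n. 1 / CD_kernel \<mu> n (z m) (z m)) \<and>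
        (\<forall>n. CD_kernel (measure_add \<mu> \<sigma>) n (z m) (z m) = complex_of_real (1 / t m) * (1 + \<epsilon> n))"
      using CD_kernel_at_point_mass[where t=t, OF J(1-3)] assms(17) m unfolding \<sigma>_def by blast
  qed
qed

end
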